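(* There is an algorithm that solves \textsc{$\alpha$-Globally Optimal Assignment} in time $\mathcal{O}^{*}(n!)$, i.e., in time $n!\cdot |x|^{\mathcal{O}(1)}$ on an input $x$ with $n$ agents.
   Context: An instance of \textsc{$\alpha$-Globally Optimal Assignment} is a tuple $(A,I,P_1,\ldots,P_\ell,\alpha)$ where $A$ is a set of $n$ agents, $I$ is a set of $m$ items, $\alpha\in\{1,\ldots,\ell\}$, and for each layer $j\in\{1,\ldots,\ell\}$ the preference profile $P_j$ assigns to every agent $a$ a preference list $<^{(j)}_a$, which is a strict linear order over a subset of $I$ (the items acceptable to $a$ in layer $j$; lists may be incomplete). A special item $b_\emptyset\notin I$ is regarded as the least preferred item of every agent. An assignment is a map $p:A\to I\cup\{b_\emptyset\}$ such that no item of $I$ is assigned to two different agents; it is legal in layer $j$ if every agent receives either $b_\emptyset$ or an item acceptable to it in layer $j$. A legal assignment $p$ is Pareto optimal in layer $j$ if there is no other legal assignment $q$ (for layer $j$) with $p(a)\le^{(j)}_a q(a)$ for all $a\in A$ and $p(a)<^{(j)}_a q(a)$ for some $a\in A$. An assignment is $\alpha$-globally optimal if there exist $\alpha$ distinct layers in each of which it is Pareto optimal. The problem asks whether an $\alpha$-globally optimal assignment exists. *)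

theory Defs
  imports Main
begin

section \<open>Globally optimal assignments\<close>

text \<open>
  Agents, items and layers are named by initial segments of the natural numbers.  The preference
  list of agent \<open>a\<close> in layer \<open>j\<close> is \<open>profiles x ! j ! a\<close>, best item first; its elements are the
  items acceptable to \<open>a\<close> in layer \<open>j\<close>.
\<close>

record goa =
  num_agents :: nat
  num_items :: nat
  profiles :: "nat list list list"
  alpha :: nat

definition num_layers :: "goa \<Rightarrow> nat" where
  "num_layers x = length (profiles x)"

definition pref :: "goa \<Rightarrow> nat \<Rightarrow> nat \<Rightarrow> nat list" where
  "pref x j a = profiles x ! j ! a"

definition goa_instance :: "goa \<Rightarrow> bool" where
  "goa_instance x \<longleftrightarrow>
     (\<forall>j < num_layers x.
        length (profiles x ! j) = num_agents x \<and>
        (\<forall>a < num_agents x.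
           distinct (pref x j a) \<and> set (pref x j a) \<subseteq> {..<num_items x})) \<and>
     1 \<le> alpha x \<and> alpha x \<le> num_layers x"

definition list_less :: "nat list \<Rightarrow> nat \<Rightarrow> nat \<Rightarrow> bool" where
  "list_less xs b c \<longleftrightarrow> (\<exists>i k. i < k \<and> k < length xs \<and> xs ! i = c \<and> xs ! k = b)"

lemma list_less_strict_linear_order:
  assumes "distinct xs"
  shows "\<not> list_less xs b b"
    and "list_less xs b c \<Longrightarrow> list_less xs c d \<Longrightarrow> list_less xs b d"
    and "b \<in> set xs \<Longrightarrow> c \<in> set xs \<Longrightarrow> b \<noteq> c \<Longrightarrow> list_less xs b c \<or> list_less xs c b"
    and "list_less xs b c \<Longrightarrow> b \<in> set xs \<and> c \<in> set xs"
proof -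
  show "\<not> list_less xs b b"
    using assms by (auto simp: list_less_def nth_eq_iff_index_eq)
  show "list_less xs b d" if bc: "list_less xs b c" and cd: "list_less xs c d"
  proof -
    obtain i k where ik: "i < k" "k < length xs" "xs ! i = c" "xs ! k = b"
      using bc unfolding list_less_def by blast
    obtain i' k' where ik': "i' < k'" "k' < length xs" "xs ! i' = d" "xs ! k' = c"
      using cd unfolding list_less_def by blast
    have "k' = i"
      using nth_eq_iff_index_eq[OF assms ik'(2), of i] ik ik' by simp
    then have "i' < k"
      using ik(1) ik'(1) by simp
    then show ?thesis
      using ik(2,4) ik'(3) unfolding list_less_def by blast
  qed
  show "list_less xs b c \<or> list_less xs c b"
    if b: "b \<in> set xs" and c: "c \<in> set xs" and neq: "b \<noteq> c"
  proof -
    obtain i where i: "i < length xs" "xs ! i = b"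
      using b by (auto simp: in_set_conv_nth)
    obtain k where k: "k < length xs" "xs ! k = c"
      using c by (auto simp: in_set_conv_nth)
    have "i < k \<or> k < i"
      using i(2) k(2) neq by (metis linorder_neqE_nat)
    then show ?thesis
      using i k unfolding list_less_def by blast
  qed
  show "b \<in> set xs \<and> c \<in> set xs" if "list_less xs b c"
    using that unfolding list_less_def by (auto intro: nth_mem)
qed

text \<open>\<open>None\<close> is the special item $b_\emptyset$, the least preferred one.\<close>

fun worse :: "nat list \<Rightarrow> nat option \<Rightarrow> nat option \<Rightarrow> bool" where
  "worse xs (Some b) (Some c) = list_less xs b c"
| "worse xs None (Some c) = (c \<in> set xs)"
| "worse xs u None = False"

definition assignment :: "goa \<Rightarrow> (nat \<Rightarrow> nat option) \<Rightarrow> bool" where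
  "assignment x p \<longleftrightarrow>
     (\<forall>a < num_agents x. \<forall>b. p a = Some b \<longrightarrow> b < num_items x) \<and>
     (\<forall>a < num_agents x. \<forall>a' < num_agents x. a \<noteq> a' \<longrightarrow> p a \<noteq> None \<longrightarrow> p a \<noteq> p a')"

definition legal :: "goa \<Rightarrow> nat \<Rightarrow> (nat \<Rightarrow> nat option) \<Rightarrow> bool" where
  "legal x j p \<longleftrightarrow>
     assignment x p \<and> (\<forall>a < num_agents x. \<forall>b. p a = Some b \<longrightarrow> b \<in> set (pref x j a))"

definition pareto_optimal :: "goa \<Rightarrow> nat \<Rightarrow> (nat \<Rightarrow> nat option) \<Rightarrow> bool" where
  "pareto_optimal x j p \<longleftrightarrow>
     legal x j p \<and>
     \<not> (\<exists>q. legal x j q \<and>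
            (\<forall>a < num_agents x. p a = q a \<or> worse (pref x j a) (p a) (q a)) \<and>
            (\<exists>a < num_agents x. worse (pref x j a) (p a) (q a)))"

definition globally_optimal :: "goa \<Rightarrow> (nat \<Rightarrow> nat option) \<Rightarrow> bool" where
  "globally_optimal x p \<longleftrightarrow>
     assignment x p \<and>
     (\<exists>L \<subseteq> {..<num_layers x}. card L = alpha x \<and> (\<forall>j \<in> L. pareto_optimal x j p))"


section \<open>Algorithms and running time\<close>

text \<open>
  The machine model is the WHILE language over binary trees of N. D. Jones, Computability and
  Complexity from a Programming Perspective (1997), with a conditional and with a stricter
  accounting of time: instead of unit cost, a step is charged the total size of the trees it reads,
  so that sharing of subtrees cannot be exploited.  Keeping each of the finitely many variables of
  a program on its own tape, written in prefix notation, a multitape Turing machine simulates every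
  step in time linear in its charge.
\<close>

datatype tree = Leaf | Node tree tree

fun nodes :: "tree \<Rightarrow> nat" where
  "nodes Leaf = 1"
| "nodes (Node l r) = 1 + nodes l + nodes r"

datatype expr = Var nat | LeafE | NodeE expr expr | HeadE expr | TailE expr

datatype com =
    Assign nat expr
  | Seq com com
  | Cond expr com com
  | While expr com

type_synonym state = "nat \<Rightarrow> tree"

fun head :: "tree \<Rightarrow> tree" where
  "head Leaf = Leaf"
| "head (Node l r) = l"

fun tail :: "tree \<Rightarrow> tree" where
  "tail Leaf = Leaf"
| "tail (Node l r) = r"

fun eval_expr :: "expr \<Rightarrow> state \<Rightarrow> tree" where
  "eval_expr (Var v) s = s v"
| "eval_expr LeafE s = Leaf"
| "eval_expr (NodeE e f) s = Node (eval_expr e s) (eval_expr f s)"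
| "eval_expr (HeadE e) s = head (eval_expr e s)"
| "eval_expr (TailE e) s = tail (eval_expr e s)"

fun charge :: "expr \<Rightarrow> state \<Rightarrow> nat" where
  "charge (Var v) s = nodes (s v)"
| "charge LeafE s = 1"
| "charge (NodeE e f) s = 1 + charge e s + charge f s"
| "charge (HeadE e) s = 1 + charge e s"
| "charge (TailE e) s = 1 + charge e s"

text \<open>\<open>exec c s t s'\<close>: started in \<open>s\<close>, the program \<open>c\<close> halts in \<open>s'\<close> after time \<open>t\<close>.
  A test succeeds unless the expression evaluates to \<open>Leaf\<close>.\<close>

inductive exec :: "com \<Rightarrow> state \<Rightarrow> nat \<Rightarrow> state \<Rightarrow> bool" where
  Assign: "exec (Assign v e) s (1 + charge e s) (s(v := eval_expr e s))"
| Seq: "exec c s t s' \<Longrightarrow> exec d s' t' s'' \<Longrightarrow> exec (Seq c d) s (t + t') s''"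
| CondTrue: "eval_expr e s \<noteq> Leaf \<Longrightarrow> exec c s t s' \<Longrightarrow>
    exec (Cond e c d) s (1 + charge e s + t) s'"
| CondFalse: "eval_expr e s = Leaf \<Longrightarrow> exec d s t s' \<Longrightarrow>
    exec (Cond e c d) s (1 + charge e s + t) s'"
| WhileFalse: "eval_expr e s = Leaf \<Longrightarrow> exec (While e c) s (1 + charge e s) s"
| WhileTrue: "eval_expr e s \<noteq> Leaf \<Longrightarrow> exec c s t s' \<Longrightarrow> exec (While e c) s' t' s'' \<Longrightarrow>
    exec (While e c) s (1 + charge e s + t + t') s''"

inductive_cases AssignE: "exec (Assign v e) s t s'"
inductive_cases SeqE: "exec (Seq c d) s t s'"
inductive_cases CondE: "exec (Cond e c d) s t s'"
inductive_cases WhileE: "exec (While e c) s t s'"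

lemma exec_deterministic:
  "exec c s t s' \<Longrightarrow> exec c s u s'' \<Longrightarrow> t = u \<and> s' = s''"
proof (induction arbitrary: u s'' rule: exec.induct)
  case (Assign v e s)
  then show ?case by (rule AssignE) simp
next
  case (Seq c s t s' d t' s2)
  obtain t1 s1 t2 where "exec c s t1 s1" "exec d s1 t2 s''" "u = t1 + t2"
    using Seq.prems by (rule SeqE)
  then show ?case using Seq.IH by blast
next
  case (CondTrue e s c t s' d)
  obtain t1 where "exec c s t1 s''" "u = 1 + charge e s + t1"
    using CondTrue.prems by (rule CondE) (use CondTrue.hyps(1) in simp_all)
  then show ?case using CondTrue.IH by blast
next
  case (CondFalse e s d t s' c)
  obtain t1 where "exec d s t1 s''" "u = 1 + charge e s + t1"
    using CondFalse.prems by (rule CondE) (use CondFalse.hyps(1) in simp_all)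
  then show ?case using CondFalse.IH by blast
next
  case (WhileFalse e s c)
  from WhileFalse.prems show ?case by (rule WhileE) (use WhileFalse.hyps in simp_all)
next
  case (WhileTrue e s c t s' t' s2)
  obtain t1 s1 t2 where
    "exec c s t1 s1" "exec (While e c) s1 t2 s''" "u = 1 + charge e s + t1 + t2"
    using WhileTrue.prems by (rule WhileE) (use WhileTrue.hyps(1) in simp_all)
  then show ?case using WhileTrue.IH by blast
qed

definition input_state :: "tree \<Rightarrow> state" where
  "input_state d = (\<lambda>v. if v = 0 then d else Leaf)"

definition accepting :: "state \<Rightarrow> bool" where
  "accepting s \<longleftrightarrow> s 0 \<noteq> Leaf"


section \<open>Encoding of instances\<close>

text \<open>
  Numbers are encoded in unary.  Up to a polynomial this does not change the length of the input:
  agents, items and layers are part of the instance, and every number occurring in it is bounded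
  by the number of agents, of items or of layers.
\<close>

fun encode_list :: "('a \<Rightarrow> tree) \<Rightarrow> 'a list \<Rightarrow> tree" where
  "encode_list f [] = Leaf"
| "encode_list f (y # ys) = Node (f y) (encode_list f ys)"

definition encode_nat :: "nat \<Rightarrow> tree" where
  "encode_nat k = encode_list (\<lambda>_. Leaf) [0..<k]"

definition encode :: "goa \<Rightarrow> tree" where
  "encode x =
     Node (encode_nat (num_agents x))
       (Node (encode_nat (num_items x))
         (Node (encode_list (encode_list (encode_list encode_nat)) (profiles x))
           (encode_nat (alpha x))))"

definition input_length :: "goa \<Rightarrow> nat" where
  "input_length x = nodes (encode x)"

lemma encode_list_inject:
  assumes "\<And>y z. f y = f z \<Longrightarrow> y = z" and "encode_list f ys = encode_list f zs"
  shows "ys = zs"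
  using assms(2)
proof (induction ys arbitrary: zs)
  case Nil
  then show ?case by (cases zs) auto
next
  case (Cons y ys)
  then show ?case by (cases zs) (auto dest: assms(1))
qed

lemma nodes_encode_nat: "nodes (encode_nat k) = 2 * k + 1"
proof -
  have "nodes (encode_list (\<lambda>_. Leaf) ys) = 2 * length ys + 1" for ys :: "nat list"
    by (induction ys) auto
  then show ?thesis by (simp add: encode_nat_def)
qed

lemma encode_nat_inject:
  assumes "encode_nat k = encode_nat l"
  shows "k = l"
proof -
  have "nodes (encode_nat k) = nodes (encode_nat l)"
    by (rule arg_cong[OF assms])
  then show ?thesis
    by (simp add: nodes_encode_nat)
qed

lemma encode_inject:
  assumes "encode x = encode y"
  shows "x = y"
proof -
  have 1: "ys = zs" if "encode_list encode_nat ys = encode_list encode_nat zs" for ys zs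
    by (rule encode_list_inject[of "encode_nat", OF _ that]) (rule encode_nat_inject)
  have 2: "ys = zs"
    if "encode_list (encode_list encode_nat) ys = encode_list (encode_list encode_nat) zs" for ys zs
    by (rule encode_list_inject[of "encode_list encode_nat", OF _ that]) (rule 1)
  have 3: "ys = zs"
    if "encode_list (encode_list (encode_list encode_nat)) ys =
        encode_list (encode_list (encode_list encode_nat)) zs" for ys zs
    by (rule encode_list_inject[of "encode_list (encode_list encode_nat)", OF _ that]) (rule 2)
  have "encode_nat (num_agents x) = encode_nat (num_agents y)"
    and "encode_nat (num_items x) = encode_nat (num_items y)"
    and "encode_list (encode_list (encode_list encode_nat)) (profiles x) =
         encode_list (encode_list (encode_list encode_nat)) (profiles y)"
    and "encode_nat (alpha x) = encode_nat (alpha y)"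
    using assms by (simp_all add: encode_def)
  then show ?thesis
    by (intro goa.equality encode_nat_inject 3) simp_all
qed

end

theory Submission
  imports Defs
begin

text \<open>
  Let the agents take turns, each taking its best remaining item.  In a fixed layer, the assignments
  obtained in this way from the orders of the agents are exactly the Pareto optimal ones: if at some
  point no remaining agent holds its best remaining item, then each of them wants an item that is
  free or held by another remaining agent, so that somebody can improve alone or a cycle of agents
  can trade.  As \<open>\<alpha> \<ge> 1\<close>, it suffices to try all \<open>n!\<close> orders in each layer.  The same
  argument yields a polynomial test for Pareto optimality of a given assignment: settle, as long as
  possible, agents that hold the best item not held by the settled agents, and check whether
  everybody gets settled.
\<close>

section \<open>Polynomial time on trees\<close>

text \<open>An order of the agents yields a candidate in a chosen layer, and this candidate may fail
  in other layers. So each pair of an order and a layer only proposes an assignment, and the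
  polynomial test counts the layers in which it is Pareto optimal. For the running time, every
  access is charged by tree size, so a list of all orders must not be carried along. The current
  order is instead a number below n! in the factorial number system, which is counted down; the loop
  state then has size polynomial in the input, each round costs a polynomial, and the factor n! is
  just the number of rounds. Costs are not analysed program by program. Polynomial-time functions on
  trees are shown closed under composition, pairing, conditionals and folds whose accumulator grows
  by a bounded amount per element. Everything done in one round is built from these; only the
  countdown is a genuine unbounded loop.\<close>

definition poly_bounded :: "(tree \<Rightarrow> nat) \<Rightarrow> bool" where
  "poly_bounded f \<longleftrightarrow> (\<exists>k. \<forall>x. f x \<le> (nodes x + 1) ^ k)"

lemma nodes_pos [simp]: "0 < nodes x"
  by (cases x) auto

lemma poly_bounded_mono:
  assumes "poly_bounded g" "\<And>x. f x \<le> g x"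
  shows "poly_bounded f"
  using assms unfolding poly_bounded_def by (meson le_trans)

text \<open>The base \<open>nodes x + 1\<close> is at least 2, so a constant can be absorbed by
  raising the exponent. The same fact absorbs the factor 2 in sums.\<close>

lemma poly_bounded_const: "poly_bounded (\<lambda>x. c)"
  unfolding poly_bounded_def
proof (intro exI allI)
  fix x :: tree
  have "c \<le> 2 ^ c"
    by simp
  also have "\<dots> \<le> (nodes x + 1) ^ c"
    using nodes_pos[of x] by (intro power_mono) linarith+
  finally show "c \<le> (nodes x + 1) ^ c" .
qed

lemma poly_bounded_nodes: "poly_bounded nodes"
  unfolding poly_bounded_def by (rule exI[of _ 1]) simp

lemma poly_bounded_mult:
  assumes "poly_bounded f" "poly_bounded g"
  shows "poly_bounded (\<lambda>x. f x * g x)"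
proof -
  obtain k l where "f x \<le> (nodes x + 1) ^ k" "g x \<le> (nodes x + 1) ^ l" for x
    using assms unfolding poly_bounded_def by blast
  then have "f x * g x \<le> (nodes x + 1) ^ (k + l)" for x
    by (simp add: power_add mult_le_mono)
  then show ?thesis
    unfolding poly_bounded_def by blast
qed

lemma poly_bounded_add:
  assumes "poly_bounded f" "poly_bounded g"
  shows "poly_bounded (\<lambda>x. f x + g x)"
proof -
  obtain k where k: "f x \<le> (nodes x + 1) ^ k" for x
    using assms unfolding poly_bounded_def by blast
  obtain l where l: "g x \<le> (nodes x + 1) ^ l" for x
    using assms unfolding poly_bounded_def by blast
  have "f x + g x \<le> (nodes x + 1) ^ (k + l + 1)" for x
  proof -
    have "f x + g x \<le> (nodes x + 1) ^ (k + l) + (nodes x + 1) ^ (k + l)"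
      using k[of x] l[of x] power_increasing[of k "k + l" "nodes x + 1"]
        power_increasing[of l "k + l" "nodes x + 1"] by linarith
    also have "\<dots> = 2 * (nodes x + 1) ^ (k + l)"
      by simp
    also have "\<dots> \<le> (nodes x + 1) * (nodes x + 1) ^ (k + l)"
      using nodes_pos[of x] by (intro mult_le_mono1) linarith
    finally show ?thesis
      by simp
  qed
  then show ?thesis
    unfolding poly_bounded_def by blast
qed

lemma poly_bounded_power:
  assumes "poly_bounded f"
  shows "poly_bounded (\<lambda>x. f x ^ k)"
  by (induction k) (simp_all add: poly_bounded_const poly_bounded_mult assms)

lemma poly_bounded_comp:
  assumes "poly_bounded f" "poly_bounded (\<lambda>x. nodes (g x))"
  shows "poly_bounded (\<lambda>x. f (g x))"
proof -
  obtain k where k: "f x \<le> (nodes x + 1) ^ k" for x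
    using assms unfolding poly_bounded_def by blast
  show ?thesis
    by (rule poly_bounded_mono[of "\<lambda>x. (nodes (g x) + 1) ^ k"])
      (intro poly_bounded_power poly_bounded_add poly_bounded_const assms, rule k)
qed

text \<open>Input and output sit in register \<open>r\<close>; the registers above \<open>r\<close> are scratch space with
  arbitrary initial contents.\<close>

definition runs :: "com \<Rightarrow> nat \<Rightarrow> (tree \<Rightarrow> tree) \<Rightarrow> (tree \<Rightarrow> nat) \<Rightarrow> bool" where
  "runs c r f T \<longleftrightarrow> (\<forall>s. \<exists>t s'. exec c s t s' \<and> s' r = f (s r) \<and> (\<forall>v < r. s' v = s v) \<and> t \<le> T (s r))"

text \<open>The program may depend on \<open>r\<close>, so that it can be placed above registers
  that must survive. The bound on the output size is what lets a time bound be composed with the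
  function that supplies its input.\<close>

definition ptime :: "(tree \<Rightarrow> tree) \<Rightarrow> bool" where
  "ptime f \<longleftrightarrow> poly_bounded (\<lambda>x. nodes (f x)) \<and>
     (\<forall>r. \<exists>c T. poly_bounded T \<and> runs c r f T)"

lemma runsD:
  "runs c r f T \<Longrightarrow>
    \<exists>t s'. exec c s t s' \<and> s' r = f (s r) \<and> (\<forall>v < r. s' v = s v) \<and> t \<le> T (s r)"
  unfolding runs_def by blast

lemma ptime_runsE:
  assumes "ptime f"
  obtains c T where "poly_bounded T" "runs c r f T"
  using assms unfolding ptime_def by blast

lemma ptimeI:
  assumes "poly_bounded (\<lambda>x. nodes (f x))"
    and "\<And>r. \<exists>c T. poly_bounded T \<and>
      (\<forall>s. \<exists>t s'. exec c s t s' \<and> s' r = f (s r) \<and> (\<forall>v < r. s' v = s v) \<and> t \<le> T (s r))"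
  shows "ptime f"
  using assms unfolding ptime_def runs_def by blast

lemma poly_bounded_ptime: "ptime f \<Longrightarrow> poly_bounded (\<lambda>x. nodes (f x))"
  unfolding ptime_def by blast

lemmas poly_bounded_intros =
  poly_bounded_const poly_bounded_nodes poly_bounded_add poly_bounded_mult poly_bounded_power

lemma exec_Assign:
  "t = 1 + charge e s \<Longrightarrow> s' = s(v := eval_expr e s) \<Longrightarrow> exec (Assign v e) s t s'"
  by (simp only: exec.Assign)

lemma ptime_id: "ptime (\<lambda>x. x)"
proof (rule ptimeI)
  show "\<exists>c T. poly_bounded T \<and>
      (\<forall>s. \<exists>t s'. exec c s t s' \<and> s' r = s r \<and> (\<forall>v < r. s' v = s v) \<and> t \<le> T (s r))" for r
    by (intro exI[of _ "Assign r (Var r)"] exI[of _ "\<lambda>x. 1 + nodes x"] conjI allI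
      poly_bounded_intros) (force intro: exec_Assign)
qed (rule poly_bounded_nodes)

lemma ptime_Leaf: "ptime (\<lambda>x. Leaf)"
proof (rule ptimeI)
  show "\<exists>c T. poly_bounded T \<and>
      (\<forall>s. \<exists>t s'. exec c s t s' \<and> s' r = Leaf \<and> (\<forall>v < r. s' v = s v) \<and> t \<le> T (s r))" for r
    by (intro exI[of _ "Assign r LeafE"] exI[of _ "\<lambda>x. 2"] conjI allI
      poly_bounded_intros) (force intro: exec_Assign)
qed (simp add: poly_bounded_const)

lemma ptime_comp:
  assumes f: "ptime f" and g: "ptime g"
  shows "ptime (\<lambda>x. f (g x))"
proof (rule ptimeI)
  show "poly_bounded (\<lambda>x. nodes (f (g x)))"
    using poly_bounded_comp[OF f[THEN poly_bounded_ptime] g[THEN poly_bounded_ptime]] .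
  fix r
  obtain c T where c: "poly_bounded T" "runs c r f T"
    using f by (rule ptime_runsE)
  obtain d U where d: "poly_bounded U" "runs d r g U"
    using g by (rule ptime_runsE)
  have "\<exists>t s'. exec (Seq d c) s t s' \<and> s' r = f (g (s r)) \<and> (\<forall>v < r. s' v = s v) \<and>
      t \<le> U (s r) + T (g (s r))" for s
  proof -
    obtain t1 s1 where 1: "exec d s t1 s1" "s1 r = g (s r)" "\<And>v. v < r \<Longrightarrow> s1 v = s v" "t1 \<le> U (s r)"
      using runsD[OF d(2), of "s"] by blast
    obtain t2 s2 where 2: "exec c s1 t2 s2" "s2 r = f (s1 r)" "\<And>v. v < r \<Longrightarrow> s2 v = s1 v"
        "t2 \<le> T (s1 r)"
      using runsD[OF c(2), of "s1"] by blast
    show ?thesis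
      by (rule exI, rule exI, rule conjI, rule exec.Seq[OF 1(1) 2(1)]) (use 1 2 in auto)
  qed
  moreover have "poly_bounded (\<lambda>x. U x + T (g x))"
    by (rule poly_bounded_add[OF d(1) poly_bounded_comp[OF c(1) poly_bounded_ptime[OF g]]])
  ultimately show "\<exists>c T. poly_bounded T \<and> (\<forall>s. \<exists>t s'. exec c s t s' \<and> s' r = f (g (s r)) \<and>
      (\<forall>v < r. s' v = s v) \<and> t \<le> T (s r))"
    by (intro exI[of _ "Seq d c"] exI[of _ "\<lambda>x. U x + T (g x)"]) blast
qed

lemma nodes_head: "nodes (head x) \<le> nodes x" and nodes_tail: "nodes (tail x) \<le> nodes x"
  by (cases x; simp)+

lemma ptime_head_aux: "ptime head"
proof (rule ptimeI)
  show "\<exists>c T. poly_bounded T \<and>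
      (\<forall>s. \<exists>t s'. exec c s t s' \<and> s' r = head (s r) \<and> (\<forall>v < r. s' v = s v) \<and> t \<le> T (s r))" for r
    by (intro exI[of _ "Assign r (HeadE (Var r))"] exI[of _ "\<lambda>x. 2 + nodes x"] conjI allI
      poly_bounded_intros) (force intro: exec_Assign)
qed (rule poly_bounded_mono[OF poly_bounded_nodes nodes_head])

lemma ptime_tail_aux: "ptime tail"
proof (rule ptimeI)
  show "\<exists>c T. poly_bounded T \<and>
      (\<forall>s. \<exists>t s'. exec c s t s' \<and> s' r = tail (s r) \<and> (\<forall>v < r. s' v = s v) \<and> t \<le> T (s r))" for r
    by (intro exI[of _ "Assign r (TailE (Var r))"] exI[of _ "\<lambda>x. 2 + nodes x"] conjI allI
      poly_bounded_intros) (force intro: exec_Assign)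
qed (rule poly_bounded_mono[OF poly_bounded_nodes nodes_tail])

lemmas ptime_head = ptime_comp[OF ptime_head_aux] and ptime_tail = ptime_comp[OF ptime_tail_aux]

text \<open>Both parts need the original input. It stays in \<open>r\<close>, and the parts run in
  \<open>r + 1\<close> and \<open>r + 2\<close>, each leaving all lower registers alone.\<close>

lemma ptime_Node:
  assumes f: "ptime f" and g: "ptime g"
  shows "ptime (\<lambda>x. Node (f x) (g x))"
proof (rule ptimeI)
  show "poly_bounded (\<lambda>x. nodes (Node (f x) (g x)))"
    unfolding nodes.simps by (intro poly_bounded_intros poly_bounded_ptime f g)
  fix r
  obtain c T where c: "poly_bounded T" "runs c (r + 1) f T"
    using f by (rule ptime_runsE)
  obtain d U where d: "poly_bounded U" "runs d (r + 2) g U"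
    using g by (rule ptime_runsE)
  let ?c = "Seq (Assign (r + 1) (Var r)) (Seq c (Seq (Assign (r + 2) (Var r)) (Seq d
    (Assign r (NodeE (Var (r + 1)) (Var (r + 2)))))))"
  let ?T = "\<lambda>x. (1 + nodes x) + (T x + ((1 + nodes x) + (U x + (2 + nodes (f x) + nodes (g x)))))"
  have "\<exists>t s'. exec ?c s t s' \<and> s' r = Node (f (s r)) (g (s r)) \<and> (\<forall>v < r. s' v = s v) \<and>
      t \<le> ?T (s r)" for s
  proof -
    let ?s = "s(r + 1 := s r)"
    obtain t1 s1 where 1: "exec c ?s t1 s1" "s1 (r + 1) = f (?s (r + 1))"
        "\<And>v. v < r + 1 \<Longrightarrow> s1 v = ?s v" "t1 \<le> T (?s (r + 1))"
      using runsD[OF c(2), of "?s"] by blast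
    let ?s1 = "s1(r + 2 := s1 r)"
    obtain t2 s2 where 2: "exec d ?s1 t2 s2" "s2 (r + 2) = g (?s1 (r + 2))"
        "\<And>v. v < r + 2 \<Longrightarrow> s2 v = ?s1 v" "t2 \<le> U (?s1 (r + 2))"
      using runsD[OF d(2), of "?s1"] by blast
    have e: "exec (Assign (r + 1) (Var r)) s (1 + nodes (s r)) ?s"
      "exec (Assign (r + 2) (Var r)) s1 (1 + nodes (s1 r)) ?s1"
      "exec (Assign r (NodeE (Var (r + 1)) (Var (r + 2)))) s2
        (2 + nodes (s2 (r + 1)) + nodes (s2 (r + 2))) (s2(r := Node (s2 (r + 1)) (s2 (r + 2))))"
      by (rule exec_Assign; simp)+
    show ?thesis
      by (rule exI, rule exI, rule conjI,
        rule exec.Seq[OF e(1) exec.Seq[OF 1(1) exec.Seq[OF e(2) exec.Seq[OF 2(1) e(3)]]]])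
        (use 1 2 in auto)
  qed
  moreover have "poly_bounded ?T"
    by (intro poly_bounded_intros c d poly_bounded_ptime f g)
  ultimately show "\<exists>c T. poly_bounded T \<and> (\<forall>s. \<exists>t s'. exec c s t s' \<and>
      s' r = Node (f (s r)) (g (s r)) \<and> (\<forall>v < r. s' v = s v) \<and> t \<le> T (s r))"
    by (intro exI[of _ ?c] exI[of _ ?T]) blast
qed

lemma ptime_If:
  assumes b: "ptime b" and f: "ptime f" and g: "ptime g"
  shows "ptime (\<lambda>x. if b x = Leaf then f x else g x)"
proof (rule ptimeI)
  show "poly_bounded (\<lambda>x. nodes (if b x = Leaf then f x else g x))"
    by (rule poly_bounded_mono[of "\<lambda>x. nodes (f x) + nodes (g x)"])
      (intro poly_bounded_intros poly_bounded_ptime f g, auto)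
  fix r
  obtain a S where a: "poly_bounded S" "runs a (r + 1) b S"
    using b by (rule ptime_runsE)
  obtain c T where c: "poly_bounded T" "runs c r f T"
    using f by (rule ptime_runsE)
  obtain d U where d: "poly_bounded U" "runs d r g U"
    using g by (rule ptime_runsE)
  let ?c = "Seq (Assign (r + 1) (Var r)) (Seq a (Cond (Var (r + 1)) d c))"
  let ?T = "\<lambda>x. (1 + nodes x) + (S x + (1 + nodes (b x) + (T x + U x)))"
  have "\<exists>t s'. exec ?c s t s' \<and> s' r = (if b (s r) = Leaf then f (s r) else g (s r)) \<and>
      (\<forall>v < r. s' v = s v) \<and> t \<le> ?T (s r)" for s
  proof -
    let ?s = "s(r + 1 := s r)"
    obtain t1 s1 where 1: "exec a ?s t1 s1" "s1 (r + 1) = b (?s (r + 1))"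
        "\<And>v. v < r + 1 \<Longrightarrow> s1 v = ?s v" "t1 \<le> S (?s (r + 1))"
      using runsD[OF a(2), of "?s"] by blast
    obtain t2 s2 where 2: "exec c s1 t2 s2" "s2 r = f (s1 r)"
        "\<And>v. v < r \<Longrightarrow> s2 v = s1 v" "t2 \<le> T (s1 r)"
      using runsD[OF c(2), of "s1"] by blast
    obtain t3 s3 where 3: "exec d s1 t3 s3" "s3 r = g (s1 r)"
        "\<And>v. v < r \<Longrightarrow> s3 v = s1 v" "t3 \<le> U (s1 r)"
      using runsD[OF d(2), of "s1"] by blast
    have e: "exec (Assign (r + 1) (Var r)) s (1 + nodes (s r)) ?s"
      by (rule exec_Assign) simp_all
    show ?thesis
    proof (cases "b (s r) = Leaf")
      case True
      then have "exec (Cond (Var (r + 1)) d c) s1 (1 + charge (Var (r + 1)) s1 + t2) s2"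
        using 1 by (intro exec.CondFalse 2(1)) simp
      from exec.Seq[OF e exec.Seq[OF 1(1) this]] show ?thesis
        by (rule_tac exI, rule_tac exI, rule_tac conjI, assumption) (use 1 2 True in auto)
    next
      case False
      then have "exec (Cond (Var (r + 1)) d c) s1 (1 + charge (Var (r + 1)) s1 + t3) s3"
        using 1 by (intro exec.CondTrue 3(1)) simp
      from exec.Seq[OF e exec.Seq[OF 1(1) this]] show ?thesis
        by (rule_tac exI, rule_tac exI, rule_tac conjI, assumption) (use 1 3 False in auto)
    qed
  qed
  moreover have "poly_bounded ?T"
    by (intro poly_bounded_intros a c d poly_bounded_ptime b)
  ultimately show "\<exists>c T. poly_bounded T \<and> (\<forall>s. \<exists>t s'. exec c s t s' \<and>
      s' r = (if b (s r) = Leaf then f (s r) else g (s r)) \<and> (\<forall>v < r. s' v = s v) \<and> t \<le> T (s r))"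
    by (intro exI[of _ ?c] exI[of _ ?T]) blast
qed

text \<open>Every tree is read as the list of trees along its right spine.\<close>

fun fold_tree :: "(tree \<Rightarrow> tree \<Rightarrow> tree) \<Rightarrow> tree \<Rightarrow> tree \<Rightarrow> tree" where
  "fold_tree g Leaf a = a"
| "fold_tree g (Node h t) a = fold_tree g t (g h a)"

text \<open>\<open>nodes l\<close> bounds the number of rounds as well as the size of each element.
  Growth by an additive \<open>K\<close> is essential: doubling in each round would be
  exponential.\<close>

lemma nodes_fold_tree:
  assumes "\<And>h a. nodes h \<le> nodes l \<Longrightarrow> nodes (g h a) \<le> nodes a + K"
  shows "nodes (fold_tree g l a) \<le> nodes a + nodes l * K"
  using assms
proof (induction l arbitrary: a)
  case (Node h l)
  have "nodes (fold_tree g l (g h a)) \<le> nodes (g h a) + nodes l * K"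
    by (intro Node.IH(2)) (simp add: Node.prems)
  also have "nodes (g h a) \<le> nodes a + K"
    by (simp add: Node.prems)
  finally show ?case
    by (simp add: algebra_simps)
qed simp

text \<open>The body sees the input, the current element and the accumulator packed into one tree.
  The bound \<open>q x h\<close> on its growth does not mention the accumulator, which keeps the
  total growth polynomial.\<close>

lemma ptime_fold_tree:
  assumes L: "ptime L" and A: "ptime A"
    and G: "ptime (\<lambda>y. G (head y) (head (tail y)) (tail (tail y)))"
    and q: "poly_bounded (\<lambda>y. q (head y) (tail y))"
    and growth: "\<And>x h a. nodes (G x h a) \<le> nodes a + q x h"
  shows "ptime (\<lambda>x. fold_tree (G x) (L x) (A x))"
proof (rule ptimeI)
  obtain k where "q (head y) (tail y) \<le> (nodes y + 1) ^ k" for y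
    using q unfolding poly_bounded_def by blast
  \<comment> \<open>Packing \<open>x\<close> and \<open>h\<close> adds one node, and the base of the
    bound adds another; this is the 2.\<close>
  from this[of "Node x y" for x y] have k: "q x h \<le> (nodes x + nodes h + 2) ^ k" for x h
    by simp
  define K where "K x = (nodes x + nodes (L x) + 2) ^ k" for x
  have K: "q x h \<le> K x" if "nodes h \<le> nodes (L x)" for x h
    using k[of x h] power_mono[of "nodes x + nodes h + 2" "nodes x + nodes (L x) + 2" k] that
    unfolding K_def by linarith
  have polyK: "poly_bounded K"
    unfolding K_def by (intro poly_bounded_intros poly_bounded_ptime L)
  have growth': "nodes (G x h a) \<le> nodes a + K x" if "nodes h \<le> nodes (L x)" for x h a
    using growth[of x h a] K[OF that] by linarith
  show "poly_bounded (\<lambda>x. nodes (fold_tree (G x) (L x) (A x)))"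
    by (rule poly_bounded_mono[of "\<lambda>x. nodes (A x) + nodes (L x) * K x"])
      (intro poly_bounded_intros poly_bounded_ptime L A polyK, intro nodes_fold_tree growth')
  define M where "M x = nodes (A x) + nodes (L x) * K x + nodes (L x)" for x
  have polyM: "poly_bounded M"
    unfolding M_def by (intro poly_bounded_intros poly_bounded_ptime L A polyK)
  fix r
  obtain a S where a: "poly_bounded S" "runs a (r + 1) A S"
    using A by (rule ptime_runsE)
  obtain c T where c: "poly_bounded T" "runs c (r + 2) L T"
    using L by (rule ptime_runsE)
  obtain d U where d: "poly_bounded U"
    "runs d (r + 3) (\<lambda>y. G (head y) (head (tail y)) (tail (tail y))) U"
    using G by (rule ptime_runsE)
  obtain m where m: "U y \<le> (nodes y + 1) ^ m" for y
    using d(1) unfolding poly_bounded_def by blast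
  \<comment> \<open>A bound for one round. The remaining list is read three times and an old and a
    new accumulator once each, whence \<open>5 * M x\<close>; the power bounds the body on its
    packed argument, and 20 covers the constants.\<close>
  define D where "D x = 20 + nodes x + 5 * M x + (nodes x + 2 * M x + 3) ^ m" for x
  have polyD: "poly_bounded D"
    unfolding D_def by (intro poly_bounded_intros polyM)
  \<comment> \<open>\<open>r\<close> keeps the input, \<open>r + 1\<close> the accumulator,
    \<open>r + 2\<close> the rest of the list, and \<open>r + 3\<close> the packed argument and then
    the result of the body.\<close>
  let ?body = "Seq (Assign (r + 3) (NodeE (Var r) (NodeE (HeadE (Var (r + 2))) (Var (r + 1)))))
    (Seq d (Seq (Assign (r + 1) (Var (r + 3))) (Assign (r + 2) (TailE (Var (r + 2))))))"
  let ?loop = "While (Var (r + 2)) ?body"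
  \<comment> \<open>The second premise is a potential: a round enlarges the accumulator by at most
    \<open>K\<close> and removes at least one node from the list, so the accumulator never exceeds
    \<open>M\<close>. The one node of the final \<open>Leaf\<close> pays for the failing
    test.\<close>
  have loop: "\<exists>t s'. exec ?loop s t s' \<and> s' (r + 1) = fold_tree (G (s r)) l (s (r + 1)) \<and>
      (\<forall>v \<le> r. s' v = s v) \<and> t \<le> nodes l * D (s r)"
    if "s (r + 2) = l" "nodes (s (r + 1)) + nodes l * K (s r) \<le> M (s r)"
      "nodes l \<le> nodes (L (s r))" for s l
    using that
  proof (induction l arbitrary: s)
    case Leaf
    have "exec ?loop s (1 + nodes (s (r + 2))) s"
      using exec.WhileFalse[of "Var (r + 2)" s ?body] Leaf by simp
    then show ?case
      by (rule_tac exI, rule_tac exI, rule_tac conjI, assumption) (use Leaf in \<open>auto simp: D_def\<close>)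
  next
    case (Node h l)
    let ?x = "s r" and ?a = "s (r + 1)"
    let ?s = "s(r + 3 := Node ?x (Node h ?a))"
    obtain t1 s1 where 1: "exec d ?s t1 s1"
        "s1 (r + 3) = G (head (?s (r + 3))) (head (tail (?s (r + 3)))) (tail (tail (?s (r + 3))))"
        "\<And>v. v < r + 3 \<Longrightarrow> s1 v = ?s v" "t1 \<le> U (?s (r + 3))"
      using runsD[OF d(2), of "?s"] by blast
    let ?s2 = "s1(r + 1 := s1 (r + 3), r + 2 := l)"
    have s1: "s1 (r + 3) = G ?x h ?a" "s1 (r + 2) = Node h l"
      using 1(2) 1(3)[of "r + 2"] Node.prems(1) by simp_all
    have x: "?s2 r = ?x"
      using 1(3)[of r] by simp
    have h: "nodes h \<le> nodes (L ?x)" and l: "nodes l \<le> nodes (L ?x)"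
      using Node.prems(3) by simp_all
    have gr: "nodes (G ?x h ?a) \<le> nodes ?a + K ?x"
      by (rule growth'[OF h])
    have inv: "nodes ?a + (1 + nodes h + nodes l) * K ?x \<le> M ?x"
      using Node.prems(2) by simp
    have "(1 + nodes h + nodes l) * K ?x = K ?x + nodes h * K ?x + nodes l * K ?x"
      by (simp add: algebra_simps)
    then have inv': "nodes (G ?x h ?a) + nodes l * K ?x \<le> M ?x"
      using gr inv by linarith
    have "\<exists>t s'. exec ?loop ?s2 t s' \<and>
        s' (r + 1) = fold_tree (G (?s2 r)) l (?s2 (r + 1)) \<and>
        (\<forall>v \<le> r. s' v = ?s2 v) \<and> t \<le> nodes l * D (?s2 r)"
      by (rule Node.IH(2)) (use x s1 inv' l in simp_all)
    then obtain t2 s2 where 2: "exec ?loop ?s2 t2 s2"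
        "s2 (r + 1) = fold_tree (G ?x) l (G ?x h ?a)"
        "\<And>v. v \<le> r \<Longrightarrow> s2 v = ?s2 v" "t2 \<le> nodes l * D ?x"
      unfolding x using s1 by auto
    let ?tb = "(4 + nodes ?x + nodes (Node h l) + nodes ?a) +
      (t1 + ((1 + nodes (s1 (r + 3))) + (2 + nodes (Node h l))))"
    have e: "exec (Assign (r + 3) (NodeE (Var r) (NodeE (HeadE (Var (r + 2))) (Var (r + 1))))) s
        (4 + nodes ?x + nodes (Node h l) + nodes ?a) ?s"
      by (rule exec_Assign) (use Node.prems(1) in simp_all)
    have e': "exec (Assign (r + 1) (Var (r + 3))) s1 (1 + nodes (s1 (r + 3))) (s1(r + 1 := s1 (r + 3)))"
      by (rule exec_Assign) simp_all
    have e'': "exec (Assign (r + 2) (TailE (Var (r + 2)))) (s1(r + 1 := s1 (r + 3)))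
        (2 + nodes (Node h l)) ?s2"
      by (rule exec_Assign) (use s1 in simp_all)
    have "exec ?body s ?tb ?s2"
      by (rule exec.Seq[OF e exec.Seq[OF 1(1) exec.Seq[OF e' e'']]])
    then have ex: "exec ?loop s (1 + nodes (Node h l) + ?tb + t2) s2"
      using exec.WhileTrue[of "Var (r + 2)" s ?body ?tb ?s2 t2 s2] 2(1) Node.prems(1) by simp
    have "nodes (Node ?x (Node h ?a)) + 1 \<le> nodes ?x + 2 * M ?x + 3"
      using inv Node.prems(3) unfolding M_def by simp
    then have "t1 \<le> (nodes ?x + 2 * M ?x + 3) ^ m"
      using 1(4) m[of "Node ?x (Node h ?a)"]
        power_mono[of "nodes (Node ?x (Node h ?a)) + 1" "nodes ?x + 2 * M ?x + 3" m]
      by (simp del: nodes.simps)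
    moreover have "nodes (Node h l) \<le> M ?x"
      using Node.prems(3) unfolding M_def by linarith
    moreover have "nodes ?a \<le> M ?x" "nodes (s1 (r + 3)) \<le> M ?x"
      using inv inv' unfolding s1 by linarith+
    ultimately have "1 + nodes (Node h l) + ?tb \<le> D ?x"
      unfolding D_def by linarith
    then have "1 + nodes (Node h l) + ?tb + t2 \<le> nodes (Node h l) * D ?x"
      using 2(4) by (simp add: algebra_simps)
    then show ?case
      using ex 2 1(3) by (intro exI[of _ "1 + nodes (Node h l) + ?tb + t2"] exI[of _ s2]) auto
  qed
  let ?c = "Seq (Assign (r + 1) (Var r)) (Seq a (Seq (Assign (r + 2) (Var r)) (Seq c
    (Seq ?loop (Assign r (Var (r + 1)))))))"
  let ?T = "\<lambda>x. (1 + nodes x) + (S x + ((1 + nodes x) + (T x +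
    (nodes (L x) * D x + (1 + nodes (fold_tree (G x) (L x) (A x)))))))"
  have "\<exists>t s'. exec ?c s t s' \<and> s' r = fold_tree (G (s r)) (L (s r)) (A (s r)) \<and>
      (\<forall>v < r. s' v = s v) \<and> t \<le> ?T (s r)" for s
  proof -
    let ?s = "s(r + 1 := s r)"
    obtain t1 s1 where 1: "exec a ?s t1 s1" "s1 (r + 1) = A (?s (r + 1))"
        "\<And>v. v < r + 1 \<Longrightarrow> s1 v = ?s v" "t1 \<le> S (?s (r + 1))"
      using runsD[OF a(2), of "?s"] by blast
    let ?s1 = "s1(r + 2 := s1 r)"
    obtain t2 s2 where 2: "exec c ?s1 t2 s2" "s2 (r + 2) = L (?s1 (r + 2))"
        "\<And>v. v < r + 2 \<Longrightarrow> s2 v = ?s1 v" "t2 \<le> T (?s1 (r + 2))"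
      using runsD[OF c(2), of "?s1"] by blast
    have s2: "s2 r = s r" "s2 (r + 1) = A (s r)" "s2 (r + 2) = L (s r)"
      using 1 2 by simp_all
    obtain t3 s3 where 3: "exec ?loop s2 t3 s3"
        "s3 (r + 1) = fold_tree (G (s2 r)) (L (s r)) (s2 (r + 1))"
        "\<And>v. v \<le> r \<Longrightarrow> s3 v = s2 v" "t3 \<le> nodes (L (s r)) * D (s2 r)"
      using loop[of s2 "L (s r)"] s2 unfolding M_def by auto
    have e: "exec (Assign (r + 1) (Var r)) s (1 + nodes (s r)) ?s"
      "exec (Assign (r + 2) (Var r)) s1 (1 + nodes (s1 r)) ?s1"
      "exec (Assign r (Var (r + 1))) s3 (1 + nodes (s3 (r + 1))) (s3(r := s3 (r + 1)))"
      by (rule exec_Assign; simp)+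
    show ?thesis
      by (rule exI, rule exI, rule conjI, rule exec.Seq[OF e(1) exec.Seq[OF 1(1) exec.Seq[OF e(2)
        exec.Seq[OF 2(1) exec.Seq[OF 3(1) e(3)]]]]]) (use 1 2 3 s2 in auto)
  qed
  moreover have "poly_bounded ?T"
    by (intro poly_bounded_intros a c poly_bounded_ptime L polyD
      \<open>poly_bounded (\<lambda>x. nodes (fold_tree (G x) (L x) (A x)))\<close>)
  ultimately show "\<exists>c T. poly_bounded T \<and> (\<forall>s. \<exists>t s'. exec c s t s' \<and>
      s' r = fold_tree (G (s r)) (L (s r)) (A (s r)) \<and> (\<forall>v < r. s' v = s v) \<and> t \<le> T (s r))"
    by (intro exI[of _ ?c] exI[of _ ?T]) blast
qed

section \<open>Pareto optimality and orders of the agents\<close>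

definition first_free :: "(nat \<times> nat option) list \<Rightarrow> nat list \<Rightarrow> nat option" where
  "first_free T l = find (\<lambda>b. Some b \<notin> snd ` set T) l"

definition serial_dictatorship :: "nat list list \<Rightarrow> nat list \<Rightarrow> (nat \<times> nat option) list" where
  "serial_dictatorship P \<pi> = fold (\<lambda>a T. (a, first_free T (P ! a)) # T) \<pi> []"

text \<open>An agent holding \<open>None\<close> can be settled again in later passes; the repeated
  entry does no harm, since only the set of entries matters.\<close>

definition settle_pass ::
    "nat list list \<Rightarrow> (nat \<times> nat option) list \<Rightarrow> (nat \<times> nat option) list \<Rightarrow> (nat \<times> nat option) list" where
  "settle_pass P = fold (\<lambda>e T. if first_free T (P ! fst e) = snd e then e # T else T)"

text \<open>As many passes as there are entries: in an order that justifies the assignment, each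
  pass settles at least the next agent.\<close>

definition settled :: "nat list list \<Rightarrow> (nat \<times> nat option) list \<Rightarrow> (nat \<times> nat option) list" where
  "settled P ps = fold (\<lambda>_. settle_pass P ps) ps []"

definition po_test :: "nat list list \<Rightarrow> (nat \<times> nat option) list \<Rightarrow> bool" where
  "po_test P ps \<longleftrightarrow> (\<forall>e \<in> set ps. \<exists>e' \<in> set (settled P ps). fst e = fst e')"

definition assoc_fun :: "(nat \<times> nat option) list \<Rightarrow> nat \<Rightarrow> nat option" where
  "assoc_fun ps a = (case map_of ps a of None \<Rightarrow> None | Some u \<Rightarrow> u)"

lemma first_free_NoneD: "first_free T l = None \<Longrightarrow> b \<in> set l \<Longrightarrow> Some b \<in> snd ` set T"
  unfolding first_free_def by (auto simp: find_None_iff)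

lemma first_free_SomeD:
  assumes "first_free T l = Some c"
  obtains i where "i < length l" "l ! i = c" "Some c \<notin> snd ` set T"
    "\<And>k. k < i \<Longrightarrow> Some (l ! k) \<in> snd ` set T"
  using assms unfolding first_free_def find_Some_iff by blast

lemma first_free_in_set: "first_free T l = Some c \<Longrightarrow> c \<in> set l"
  by (elim first_free_SomeD) auto

lemma first_free_not_taken: "first_free T l = Some c \<Longrightarrow> Some c \<notin> snd ` set T"
  by (elim first_free_SomeD)

text \<open>A settled agent already holds the best item that the settled agents leave over; hence, by
  induction on the order of settling, no weak improvement \<open>q\<close> moves a settled agent.\<close>

lemma first_free_improvement_eq:
  assumes d: "distinct l"
    and imp: "p a = q a \<or> worse l (p a) (q a)"
    and ff: "first_free T l = p a"
    and T: "\<And>b u. (b, u) \<in> set T \<Longrightarrow> b < n \<and> p b = u \<and> q b = u"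
    and inj: "\<And>b. b < n \<Longrightarrow> a \<noteq> b \<Longrightarrow> q a \<noteq> None \<Longrightarrow> q a \<noteq> q b"
  shows "q a = p a"
proof (rule ccontr)
  assume neq: "q a \<noteq> p a"
  then have w: "worse l (p a) (q a)"
    using imp by auto
  then obtain e where e: "q a = Some e"
    by (cases "q a") auto
  have "Some e \<in> snd ` set T"
  proof (cases "p a")
    case None
    then show ?thesis
      using w e ff first_free_NoneD by auto
  next
    case (Some c)
    obtain i where i: "i < length l" "l ! i = c" "\<And>k. k < i \<Longrightarrow> Some (l ! k) \<in> snd ` set T"
      using ff Some by (auto elim: first_free_SomeD)
    obtain j k where jk: "j < k" "k < length l" "l ! j = e" "l ! k = c"
      using w Some e by (auto simp: list_less_def)
    have "k = i"
      using i jk d by (metis nth_eq_iff_index_eq)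
    then show ?thesis
      using i(3)[of j] jk by auto
  qed
  then obtain b where b: "(b, Some e) \<in> set T"
    by auto
  have "b \<noteq> a"
    using T[OF b] e neq by auto
  then show False
    using inj[of b] T[OF b] e by auto
qed

section \<open>Settling entries one by one\<close>

lemma settle_pass_induct [consumes 1, case_names init step]:
  assumes "set es \<subseteq> set ps" "Q T"
    and "\<And>e T. e \<in> set ps \<Longrightarrow> first_free T (P ! fst e) = snd e \<Longrightarrow> Q T \<Longrightarrow> Q (e # T)"
  shows "Q (settle_pass P es T)"
  using assms(1,2) unfolding settle_pass_def
  by (induction es arbitrary: T) (auto intro: assms(3))

text \<open>Soundness does not depend on how settling is organised in passes: a property kept by
  settling a single entry survives them all.\<close>

lemma settled_induct [case_names Nil step]:
  assumes "Q []"
    and "\<And>e T. e \<in> set ps \<Longrightarrow> first_free T (P ! fst e) = snd e \<Longrightarrow> Q T \<Longrightarrow> Q (e # T)"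
  shows "Q (settled P ps)"
proof -
  have "Q T \<Longrightarrow> Q (fold (\<lambda>_. settle_pass P ps) es T)" for es :: "(nat \<times> nat option) list" and T
    by (induction es arbitrary: T) (auto intro: settle_pass_induct[of ps] assms(2))
  then show ?thesis
    using assms(1) unfolding settled_def by blast
qed

lemma settle_pass_mono: "set T \<subseteq> set (settle_pass P es T)"
proof (induction es arbitrary: T)
  case (Cons e es)
  show ?case
    using Cons[of T] Cons[of "e # T"] by (auto simp: settle_pass_def)
qed (simp add: settle_pass_def)

text \<open>Other entries may be settled before the pass reaches \<open>(a, u)\<close>, so its
  condition is required for every set between \<open>T\<close> and \<open>ps\<close>.\<close>

lemma settle_pass_adds:
  assumes "(a, u) \<in> set es" "set es \<subseteq> set ps" "set T \<subseteq> set ps"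
    and "\<And>T'. set T \<subseteq> set T' \<Longrightarrow> set T' \<subseteq> set ps \<Longrightarrow> (a, u) \<in> set T' \<or> first_free T' (P ! a) = u"
  shows "(a, u) \<in> set (settle_pass P es T)"
  using assms
proof (induction es arbitrary: T)
  case (Cons e es)
  let ?T = "if first_free T (P ! fst e) = snd e then e # T else T"
  have eq: "settle_pass P (e # es) T = settle_pass P es ?T"
    by (simp add: settle_pass_def)
  have sub: "set T \<subseteq> set ?T" "set ?T \<subseteq> set ps"
    using Cons.prems by auto
  show ?case
  proof (cases "(a, u) \<in> set es")
    case True
    have "(a, u) \<in> set (settle_pass P es ?T)"
    proof (rule Cons.IH)
      fix T' assume "set ?T \<subseteq> set T'" "set T' \<subseteq> set ps"
      then show "(a, u) \<in> set T' \<or> first_free T' (P ! a) = u"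
        using Cons.prems(4)[of T'] sub(1) by blast
    qed (use True Cons.prems sub in auto)
    then show ?thesis
      unfolding eq .
  next
    case False
    then have e: "e = (a, u)"
      using Cons.prems(1) by auto
    have "(a, u) \<in> set ?T"
      using Cons.prems(4)[of T] Cons.prems(3) unfolding e by auto
    then show ?thesis
      unfolding eq using settle_pass_mono by blast
  qed
qed simp

text \<open>Settling agents in the order \<open>\<pi>\<close> yields \<open>p\<close>.\<close>

definition justified :: "nat list list \<Rightarrow> (nat \<Rightarrow> nat option) \<Rightarrow> nat list \<Rightarrow> bool" where
  "justified P p \<pi> \<longleftrightarrow>
     (\<forall>i < length \<pi>. first_free (map (\<lambda>a. (a, p a)) (take i \<pi>)) (P ! (\<pi> ! i)) = p (\<pi> ! i))"

lemma justified_snoc: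
  "justified P p (\<pi> @ [a]) \<longleftrightarrow>
    justified P p \<pi> \<and> first_free (map (\<lambda>a. (a, p a)) \<pi>) (P ! a) = p a"
  unfolding justified_def by (auto simp: nth_append less_Suc_eq)

lemma first_free_cong: "set S = set T \<Longrightarrow> first_free S = first_free T"
  unfolding first_free_def by auto

section \<open>Outcomes of serial dictatorship\<close>

lemma serial_dictatorship_justified:
  assumes "justified P p \<pi>"
  shows "serial_dictatorship P \<pi> = rev (map (\<lambda>a. (a, p a)) \<pi>)"
  using assms
proof (induction \<pi> rule: rev_induct)
  case (snoc a \<pi>)
  have "first_free (rev (map (\<lambda>a. (a, p a)) \<pi>)) = first_free (map (\<lambda>a. (a, p a)) \<pi>)"
    by (rule first_free_cong) simp
  then show ?case
    using snoc unfolding justified_snoc by (simp add: serial_dictatorship_def)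
qed (simp add: serial_dictatorship_def)

lemma fst_serial_dictatorship: "map fst (serial_dictatorship P \<pi>) = rev \<pi>"
  by (induction \<pi> rule: rev_induct) (simp_all add: serial_dictatorship_def)

lemma serial_dictatorship_items:
  assumes "(a, Some b) \<in> set (serial_dictatorship P \<pi>)"
  shows "a \<in> set \<pi> \<and> b \<in> set (P ! a)"
  using assms
  by (induction \<pi> rule: rev_induct) (auto simp: serial_dictatorship_def dest!: first_free_in_set[OF sym])

lemma serial_dictatorship_inj:
  assumes "distinct \<pi>" "(a, Some b) \<in> set (serial_dictatorship P \<pi>)"
    "(a', Some b) \<in> set (serial_dictatorship P \<pi>)"
  shows "a = a'"
  using assms
proof (induction \<pi> rule: rev_induct)
  case (snoc c \<pi>)
  have eq: "serial_dictatorship P (\<pi> @ [c]) =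
      (c, first_free (serial_dictatorship P \<pi>) (P ! c)) # serial_dictatorship P \<pi>"
    by (simp add: serial_dictatorship_def)
  have "(e, Some b) \<notin> set (serial_dictatorship P \<pi>)"
    if "first_free (serial_dictatorship P \<pi>) (P ! c) = Some b" for e
    using first_free_not_taken[OF that] by force
  then show ?case
    using snoc unfolding eq by (auto dest!: sym[of "Some b"])
qed (simp add: serial_dictatorship_def)

lemma assoc_fun_eq: "distinct (map fst ps) \<Longrightarrow> (a, u) \<in> set ps \<Longrightarrow> assoc_fun ps a = u"
  by (simp add: assoc_fun_def)

text \<open>All items before the first free one are taken, and the item in \<open>u\<close> is not,
  so it can only stand later in the list.\<close>

lemma worse_first_free:
  assumes ff: "first_free T l = Some f" "Some f \<noteq> u"
    and u: "u \<notin> snd ` set T \<or> u = None" "\<And>c. u = Some c \<Longrightarrow> c \<in> set l"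
  shows "worse l u (Some f)"
proof (cases u)
  case None
  then show ?thesis
    using first_free_in_set[OF ff(1)] by simp
next
  case (Some c)
  obtain i where i: "i < length l" "l ! i = f" "\<And>k. k < i \<Longrightarrow> Some (l ! k) \<in> snd ` set T"
    using ff(1) by (auto elim: first_free_SomeD)
  obtain k where k: "k < length l" "l ! k = c"
    using u(2)[OF Some] by (auto simp: in_set_conv_nth)
  have "\<not> k < i" "k \<noteq> i"
    using i k u(1) ff(2) Some by auto
  then have "i < k"
    by simp
  then show ?thesis
    using i k Some by (auto simp: list_less_def)
qed

text \<open>Replacing \<open>S\<close> by its image until it is stable leaves a union of cycles of
  \<open>g\<close>. This supplies the trading cycles without following a path explicitly.\<close>

lemma exists_invariant_subset:
  assumes "finite S" "S \<noteq> {}" "g ` S \<subseteq> S"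
  obtains C where "C \<subseteq> S" "C \<noteq> {}" "g ` C = C"
  using assms
proof (induction S arbitrary: thesis rule: finite_psubset_induct)
  case (psubset S)
  show ?case
  proof (cases "g ` S = S")
    case True
    then show ?thesis
      using psubset.prems(1,2) by blast
  next
    case False
    show ?thesis
    proof (rule psubset.IH[of "g ` S"])
      show "g ` S \<subset> S"
        using False psubset.prems(3) by blast
      show "thesis" if "C \<subseteq> g ` S" "C \<noteq> {}" "g ` C = C" for C
        using psubset.prems(1)[of C] psubset.prems(3) that by blast
    qed (use psubset.prems in auto)
  qed
qed

text \<open>The count is over positions in the list of profiles, because distinct layers may carry
  equal profiles.\<close>

definition order_test :: "goa \<Rightarrow> nat list \<Rightarrow> bool" where
  "order_test x \<pi> \<longleftrightarrow> (\<exists>P \<in> set (profiles x).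
     alpha x \<le> length (filter (\<lambda>P'. po_test P' (serial_dictatorship P \<pi>)) (profiles x)))"

context
  fixes x :: goa
  assumes inst: "goa_instance x"
begin

lemma pref_facts:
  assumes "j < num_layers x" "a < num_agents x"
  shows "distinct (pref x j a)" "set (pref x j a) \<subseteq> {..<num_items x}"
  using inst assms unfolding goa_instance_def by auto

lemma assignment_serial_dictatorship:
  assumes j: "j < num_layers x" and \<pi>: "distinct \<pi>" "set \<pi> = {..<num_agents x}"
  defines "ps \<equiv> serial_dictatorship (profiles x ! j) \<pi>"
  shows "assignment x (assoc_fun ps)" "distinct (map fst ps)"
    "set ps = (\<lambda>a. (a, assoc_fun ps a)) ` {..<num_agents x}"
proof -
  show d: "distinct (map fst ps)"
    unfolding ps_def fst_serial_dictatorship using \<pi> by simp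
  have dom: "fst ` set ps = {..<num_agents x}"
    using arg_cong[OF fst_serial_dictatorship[of "profiles x ! j" \<pi>], of set] \<pi>(2) by (simp add: ps_def)
  have mem: "(a, assoc_fun ps a) \<in> set ps" if "a < num_agents x" for a
  proof -
    have "a \<in> fst ` set ps"
      using dom that by simp
    then show ?thesis
      using assoc_fun_eq[OF d] by force
  qed
  show "set ps = (\<lambda>a. (a, assoc_fun ps a)) ` {..<num_agents x}"
  proof (intro equalityI subsetI)
    fix e assume e: "e \<in> set ps"
    then have "fst e < num_agents x" "assoc_fun ps (fst e) = snd e"
      using dom assoc_fun_eq[OF d, of "fst e" "snd e"] by auto
    then show "e \<in> (\<lambda>a. (a, assoc_fun ps a)) ` {..<num_agents x}"
      by (intro image_eqI[of _ _ "fst e"]) simp_all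
  qed (use mem in auto)
  show "assignment x (assoc_fun ps)"
    unfolding assignment_def
  proof (intro conjI allI impI)
    fix a b assume a: "a < num_agents x" "assoc_fun ps a = Some b"
    then have "b \<in> set (pref x j a)"
      using mem[of a] serial_dictatorship_items unfolding ps_def pref_def by metis
    then show "b < num_items x"
      using pref_facts(2)[OF j a(1)] by auto
  next
    fix a a' assume a: "a < num_agents x" "a' < num_agents x" "a \<noteq> a'" "assoc_fun ps a \<noteq> None"
    then obtain b where b: "assoc_fun ps a = Some b"
      by auto
    then show "assoc_fun ps a \<noteq> assoc_fun ps a'"
      using mem[OF a(1)] mem[OF a(2)] serial_dictatorship_inj[OF \<pi>(1), of a b "profiles x ! j" a'] a(3)
      unfolding ps_def by auto
  qed
qed

lemma po_test_sound:
  assumes j: "j < num_layers x" and p: "assignment x p"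
    and ps: "set ps = (\<lambda>a. (a, p a)) ` {..<num_agents x}"
    and test: "po_test (profiles x ! j) ps"
  shows "pareto_optimal x j p"
proof -
  have cover: "\<exists>u. (a, u) \<in> set (settled (profiles x ! j) ps)" if "a < num_agents x" for a
    using test ps that unfolding po_test_def by force
  \<comment> \<open>The test also certifies legality: the item of a settled agent was found in its
    list.\<close>
  have "\<forall>(a, u) \<in> set (settled (profiles x ! j) ps).
      a < num_agents x \<and> u = p a \<and> (\<forall>b. u = Some b \<longrightarrow> b \<in> set (pref x j a))"
    by (induction rule: settled_induct) (use ps in \<open>auto simp: pref_def dest: first_free_in_set\<close>)
  then have legal: "legal x j p"
    using p cover unfolding legal_def by fast
  have "p a = q a" if q: "legal x j q" "\<And>a. a < num_agents x \<Longrightarrow> p a = q a \<or> worse (pref x j a) (p a) (q a)"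
    and a: "a < num_agents x" for q a
  proof -
    have "\<forall>(a, u) \<in> set (settled (profiles x ! j) ps). a < num_agents x \<and> p a = u \<and> q a = u"
    proof (induction rule: settled_induct)
      case (step e T)
      obtain a where e: "e = (a, p a)" and a: "a < num_agents x"
        using step.hyps(1) ps by auto
      have "q a = p a"
      proof (rule first_free_improvement_eq)
        show "distinct (pref x j a)"
          by (rule pref_facts[OF j a])
        show "first_free T (pref x j a) = p a"
          using step.hyps(2) by (simp add: e pref_def)
        show "p a = q a \<or> worse (pref x j a) (p a) (q a)"
          by (rule q(2)[OF a])
        show "b < num_agents x \<and> p b = u \<and> q b = u" if "(b, u) \<in> set T" for b u
          using step.IH that by auto
        show "q a \<noteq> q b" if "b < num_agents x" "a \<noteq> b" "q a \<noteq> None" for b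
          using q(1) a that unfolding legal_def assignment_def by blast
      qed
      then show ?case
        using step.IH a by (simp add: e)
    qed simp
    then show ?thesis
      using cover[OF a] by fastforce
  qed
  moreover have "\<not> worse l u u" if "distinct l" for l u
    using list_less_strict_linear_order(1)[OF that] by (cases u) auto
  ultimately show ?thesis
    unfolding pareto_optimal_def using legal pref_facts(1)[OF j] by metis
qed

text \<open>If no further agent can be settled, then every unsettled agent wants an item that is free or
  held by another unsettled agent, which gives an improvement or a trading cycle.\<close>

lemma pareto_optimal_next:
  assumes j: "j < num_layers x" and po: "pareto_optimal x j p"
    and \<pi>: "set \<pi> \<subset> {..<num_agents x}"
  shows "\<exists>a < num_agents x. a \<notin> set \<pi> \<and> first_free (map (\<lambda>a. (a, p a)) \<pi>) (pref x j a) = p a"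
proof (rule ccontr)
  assume none: "\<not> ?thesis"
  let ?T = "map (\<lambda>a. (a, p a)) \<pi>"
  define S where "S = {..<num_agents x} - set \<pi>"
  have legal: "legal x j p"
    using po unfolding pareto_optimal_def by blast
  have inj: "p a \<noteq> p b" if "a < num_agents x" "b < num_agents x" "a \<noteq> b" "p a \<noteq> None" for a b
    using legal that unfolding legal_def assignment_def by blast
  have no_imp: False
    if "legal x j q" "\<And>a. a < num_agents x \<Longrightarrow> p a = q a \<or> worse (pref x j a) (p a) (q a)"
      "\<exists>a < num_agents x. worse (pref x j a) (p a) (q a)" for q
    using po that unfolding pareto_optimal_def by blast
  have item: "b \<in> set (pref x j a)" if "a < num_agents x" "p a = Some b" for a b
    using legal that unfolding legal_def by blast
  have own: "p a \<notin> snd ` set ?T \<or> p a = None" if "a \<in> S" for a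
    using that inj \<pi> unfolding S_def by fastforce
  \<comment> \<open>If nothing were left for \<open>a\<close>, then \<open>none\<close> would force
    \<open>p a\<close> to be an item; that item would be held by an agent of the prefix, against
    \<open>own\<close>.\<close>
  have "\<exists>f. first_free ?T (pref x j a) = Some f" if a: "a \<in> S" for a
  proof (rule ccontr)
    assume "\<not> ?thesis"
    then have ff: "first_free ?T (pref x j a) = None"
      by auto
    then obtain c where c: "p a = Some c"
      using none a unfolding S_def by fastforce
    then show False
      using own[OF a] first_free_NoneD[OF ff item[OF _ c]] a unfolding S_def by auto
  qed
  then obtain f where f: "\<And>a. a \<in> S \<Longrightarrow> first_free ?T (pref x j a) = Some (f a)"
    by metis
  have f_item: "f a \<in> set (pref x j a)" if "a \<in> S" for a
    using f[OF that] by (rule first_free_in_set)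
  have f_range: "f a < num_items x" if "a \<in> S" for a
    using f_item[OF that] pref_facts(2)[OF j, of a] that unfolding S_def by auto
  have f_better: "worse (pref x j a) (p a) (Some (f a))" if a: "a \<in> S" for a
    using a none f[OF a] own[OF a] item[of a]
    by (intro worse_first_free[OF f[OF a]]) (auto simp: S_def)
  have f_free: "Some (f a) \<noteq> p b" if a: "a \<in> S" and b: "b \<in> set \<pi>" for a b
    using first_free_not_taken[OF f[OF a]] b by (metis (no_types, lifting) image_eqI list.set_map snd_conv)
  have S: "S \<noteq> {}" "S \<subseteq> {..<num_agents x}" "finite S"
    using \<pi> unfolding S_def by auto
  show False
  proof (cases "\<exists>a \<in> S. \<forall>b < num_agents x. Some (f a) \<noteq> p b")
    case True
    then obtain a where a: "a \<in> S" "\<And>b. b < num_agents x \<Longrightarrow> p b \<noteq> Some (f a)"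
      by metis
    let ?q = "p(a := Some (f a))"
    have "legal x j ?q"
      using legal a f_item[OF a(1)] f_range[OF a(1)] a(2)[THEN not_sym]
      unfolding legal_def assignment_def by auto
    then show False
      by (rule no_imp) (use f_better[OF a(1)] a(1) S(2) in auto)
  next
    case False
    then have "\<exists>b \<in> S. Some (f a) = p b" if "a \<in> S" for a
      using that f_free unfolding S_def by blast
    then obtain g where g: "\<And>a. a \<in> S \<Longrightarrow> g a \<in> S \<and> p (g a) = Some (f a)"
      by metis
    have gS: "g ` S \<subseteq> S"
      using g by blast
    obtain C where C: "C \<subseteq> S" "C \<noteq> {}" "g ` C = C"
      by (rule exists_invariant_subset[OF S(3,1) gS])
    have "inj_on g C"
      using C S(3) by (intro eq_card_imp_inj_on) (auto intro: finite_subset)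
    let ?q = "\<lambda>a. if a \<in> C then Some (f a) else p a"
    \<comment> \<open>In the trade \<open>a\<close> receives the item of \<open>g a\<close>. Thus
      \<open>?q\<close> is \<open>p\<close> after the map that is \<open>g\<close> on
      \<open>C\<close> and the identity elsewhere; \<open>g\<close> permutes \<open>C\<close>, so
      this map is injective and no item is handed out twice.\<close>
    have qp: "?q a = (if a \<in> C then p (g a) else p a)" for a
      using g C(1) by auto
    have gC: "g a \<in> C" if "a \<in> C" for a
      using C(3) that by blast
    have lt: "g a < num_agents x" if "a \<in> C" for a
      using gC[OF that] C(1) S(2) by auto
    have "?q a \<noteq> ?q b" if "a < num_agents x" "b < num_agents x" "a \<noteq> b" "?q a \<noteq> None" for a b
    proof -
      have "(if a \<in> C then g a else a) \<noteq> (if b \<in> C then g b else b)"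
        using gC inj_onD[OF \<open>inj_on g C\<close>, of a b] that(3) by (auto split: if_splits)
      then show ?thesis
        using that inj[of "if a \<in> C then g a else a" "if b \<in> C then g b else b"] lt
        unfolding qp by (auto split: if_splits)
    qed
    moreover have "b < num_items x \<and> b \<in> set (pref x j a)" if "a < num_agents x" "?q a = Some b" for a b
      using that f_item f_range C(1) item[of a b] pref_facts(2)[OF j that(1)]
      by (auto split: if_splits)
    ultimately have "legal x j ?q"
      unfolding legal_def assignment_def by blast
    moreover have "worse (pref x j a) (p a) (?q a)" if "a \<in> C" for a
      using f_better[of a] that C(1) by auto
    ultimately show False
      using C(1,2) S(2) by (intro no_imp[of ?q]) auto
  qed
qed

text \<open>Any justified prefix can be prolonged by \<open>pareto_optimal_next\<close>, so the
  order is built greedily and no choice has to be revised.\<close>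

lemma pareto_optimal_order:
  assumes j: "j < num_layers x" and po: "pareto_optimal x j p"
  obtains \<pi> where "distinct \<pi>" "set \<pi> = {..<num_agents x}" "justified (profiles x ! j) p \<pi>"
proof -
  have "\<exists>\<pi>. distinct \<pi> \<and> set \<pi> \<subseteq> {..<num_agents x} \<and> length \<pi> = k \<and>
      justified (profiles x ! j) p \<pi>"
    if "k \<le> num_agents x" for k
    using that
  proof (induction k)
    case 0
    then show ?case
      by (simp add: justified_def)
  next
    case (Suc k)
    then obtain \<pi> where \<pi>: "distinct \<pi>" "set \<pi> \<subseteq> {..<num_agents x}" "length \<pi> = k"
        "justified (profiles x ! j) p \<pi>"
      by auto
    have "set \<pi> \<noteq> {..<num_agents x}"
    proof
      assume "set \<pi> = {..<num_agents x}"
      then have "k = num_agents x"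
        using distinct_card[OF \<pi>(1)] \<pi>(3) by simp
      then show False
        using Suc.prems by simp
    qed
    then have "set \<pi> \<subset> {..<num_agents x}"
      using \<pi>(2) by blast
    then obtain a where "a < num_agents x" "a \<notin> set \<pi>"
        "first_free (map (\<lambda>a. (a, p a)) \<pi>) (pref x j a) = p a"
      using pareto_optimal_next[OF j po] by blast
    then show ?case
      using \<pi> by (intro exI[of _ "\<pi> @ [a]"]) (auto simp: justified_snoc pref_def)
  qed
  then obtain \<pi> where \<pi>: "distinct \<pi>" "set \<pi> \<subseteq> {..<num_agents x}" "length \<pi> = num_agents x"
      "justified (profiles x ! j) p \<pi>"
    by blast
  have "set \<pi> = {..<num_agents x}"
    using \<pi> distinct_card[of \<pi>] by (intro card_subset_eq) auto
  then show ?thesis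
    using that \<pi> by blast
qed

text \<open>The passes do not know a justifying order, yet after \<open>k\<close> of them its first
  \<open>k\<close> agents are settled: settling further agents early never prevents an agent from
  being settled.\<close>

lemma po_test_complete:
  assumes j: "j < num_layers x" and po: "pareto_optimal x j p"
    and ps: "set ps = (\<lambda>a. (a, p a)) ` {..<num_agents x}" "length ps = num_agents x"
  shows "po_test (profiles x ! j) ps"
proof -
  let ?P = "profiles x ! j"
  obtain \<pi> where \<pi>: "distinct \<pi>" "set \<pi> = {..<num_agents x}" "justified ?P p \<pi>"
    by (rule pareto_optimal_order[OF j po])
  have inj: "p a \<noteq> p b" if "a < num_agents x" "b < num_agents x" "a \<noteq> b" "p a \<noteq> None" for a b
    using po that unfolding pareto_optimal_def legal_def assignment_def by blast
  have len: "length \<pi> = num_agents x"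
    using \<pi>(1,2) distinct_card[of \<pi>] by simp
  have rounds: "set T \<subseteq> set ps \<and> (\<lambda>a. (a, p a)) ` set (take k \<pi>) \<subseteq> set T"
    if "T = (settle_pass ?P ps ^^ k) []" "k \<le> num_agents x" for k T
    using that
  proof (induction k arbitrary: T)
    case (Suc k)
    let ?T = "(settle_pass ?P ps ^^ k) []"
    have IH: "set ?T \<subseteq> set ps" "(\<lambda>a. (a, p a)) ` set (take k \<pi>) \<subseteq> set ?T"
      using Suc by auto
    have T: "T = settle_pass ?P ps ?T"
      using Suc.prems by simp
    have k: "k < length \<pi>"
      using Suc.prems len by simp
    define a where "a = \<pi> ! k"
    have a: "a < num_agents x"
      using k \<pi>(2) nth_mem[OF k] unfolding a_def by auto
    have ff: "first_free (map (\<lambda>a. (a, p a)) (take k \<pi>)) (?P ! a) = p a"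
      using \<pi>(3) k unfolding justified_def a_def by blast
    have "(a, p a) \<in> set (settle_pass ?P ps ?T)"
    proof (rule settle_pass_adds)
      show "(a, p a) \<in> set ps"
        using a ps by auto
      fix T' assume T': "set ?T \<subseteq> set T'" "set T' \<subseteq> set ps"
      have sub: "snd ` set (map (\<lambda>a. (a, p a)) (take k \<pi>)) \<subseteq> snd ` set T'"
        using T'(1) IH(2) by auto
      \<comment> \<open>Additional settled agents only take more items. If
        \<open>p a = None\<close>, the list of \<open>a\<close> stays exhausted. If
        \<open>p a = Some c\<close>, the items above \<open>c\<close> stay taken, and
        \<open>c\<close> itself can be taken only by \<open>a\<close>, since the entries of
        \<open>T'\<close> come from \<open>p\<close>.\<close>
      show "(a, p a) \<in> set T' \<or> first_free T' (?P ! a) = p a"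
      proof (rule disjCI)
        assume new: "first_free T' (?P ! a) \<noteq> p a"
        show "(a, p a) \<in> set T'"
        proof (cases "p a")
          case None
          have "first_free T' (?P ! a) = None"
            using first_free_NoneD[OF ff[unfolded None]] sub
            unfolding first_free_def find_None_iff by blast
          then show ?thesis
            using new None by simp
        next
          case (Some c)
          obtain i where i: "i < length (?P ! a)" "?P ! a ! i = c"
              "\<And>l. l < i \<Longrightarrow> Some (?P ! a ! l) \<in> snd ` set (map (\<lambda>a. (a, p a)) (take k \<pi>))"
            using ff Some by (auto elim: first_free_SomeD)
          have "Some c \<in> snd ` set T'"
          proof (rule ccontr)
            assume "Some c \<notin> snd ` set T'"
            then have "first_free T' (?P ! a) = Some c"
              using i sub unfolding first_free_def find_Some_iff by blast
            then show False
              using new Some by simp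
          qed
          then obtain b where b: "(b, Some c) \<in> set T'"
            by auto
          then have "b < num_agents x" "p b = Some c"
            using T'(2) ps by auto
          then have "b = a"
            using inj[of b a] a Some by auto
          then show ?thesis
            using b Some by simp
        qed
      qed
    qed (use IH in auto)
    moreover have "set (settle_pass ?P ps ?T) \<subseteq> set ps"
      by (rule settle_pass_induct[of ps ps]) (use IH(1) in auto)
    moreover have "(\<lambda>a. (a, p a)) ` set (take k \<pi>) \<subseteq> set (settle_pass ?P ps ?T)"
      using IH(2) settle_pass_mono by blast
    ultimately show ?case
      unfolding T by (simp add: take_Suc_conv_app_nth[OF k] a_def)
  qed simp
  have fold: "fold (\<lambda>_. h) es T = (h ^^ length es) T" for h es and T :: "'b" 
    by (induction es arbitrary: T) (simp_all add: funpow_swap1)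
  have "(\<lambda>a. (a, p a)) ` {..<num_agents x} \<subseteq> set (settled ?P ps)"
    using rounds[OF refl order_refl] \<pi>(2) len unfolding settled_def fold ps(2) by simp
  then show ?thesis
    unfolding po_test_def ps(1) by force
qed

text \<open>Assignments are functions on all numbers, but an association list recovers
  \<open>p\<close> only on the agents; this lemma bridges the difference.\<close>

lemma pareto_optimal_cong:
  assumes "\<And>a. a < num_agents x \<Longrightarrow> p a = q a"
  shows "pareto_optimal x j p = pareto_optimal x j q"
  using assms unfolding pareto_optimal_def legal_def assignment_def by simp

lemma order_test_iff:
  assumes \<pi>: "distinct \<pi>" "set \<pi> = {..<num_agents x}"
  shows "order_test x \<pi> \<longleftrightarrow> (\<exists>j < num_layers x.
    alpha x \<le> card {j'. j' < num_layers x \<and>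
      pareto_optimal x j' (assoc_fun (serial_dictatorship (profiles x ! j) \<pi>))})"
proof -
  have "length (filter (\<lambda>P'. po_test P' (serial_dictatorship (profiles x ! j) \<pi>)) (profiles x)) =
    card {j'. j' < num_layers x \<and>
      pareto_optimal x j' (assoc_fun (serial_dictatorship (profiles x ! j) \<pi>))}"
    if j: "j < num_layers x" for j
  proof -
    let ?ps = "serial_dictatorship (profiles x ! j) \<pi>"
    note A = assignment_serial_dictatorship[OF j \<pi>]
    have len: "length ?ps = num_agents x"
      using arg_cong[OF fst_serial_dictatorship[of "profiles x ! j" \<pi>], of length] \<pi>
        distinct_card[of \<pi>] by simp
    have "po_test (profiles x ! j') ?ps = pareto_optimal x j' (assoc_fun ?ps)"
      if "j' < num_layers x" for j'
      using po_test_sound[OF that A(1,3)] po_test_complete[OF that _ A(3) len] by blast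
    then show ?thesis
      unfolding length_filter_conv_card num_layers_def
      by (intro arg_cong[of _ _ card] Collect_cong) blast
  qed
  then show ?thesis
    unfolding order_test_def all_set_conv_all_nth Bex_def in_set_conv_nth
    by (auto simp: num_layers_def)
qed

lemma globally_optimal_iff_order_test:
  "(\<exists>p. globally_optimal x p) \<longleftrightarrow> (\<exists>\<pi>. distinct \<pi> \<and> set \<pi> = {..<num_agents x} \<and> order_test x \<pi>)"
proof
  assume "\<exists>p. globally_optimal x p"
  then obtain p L where L: "L \<subseteq> {..<num_layers x}" "card L = alpha x" "\<And>j. j \<in> L \<Longrightarrow> pareto_optimal x j p"
    unfolding globally_optimal_def by blast
  have "alpha x \<ge> 1"
    using inst unfolding goa_instance_def by blast
  then obtain j where j: "j \<in> L"
    using L(2) by fastforce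
  then have jl: "j < num_layers x"
    using L(1) by auto
  obtain \<pi> where \<pi>: "distinct \<pi>" "set \<pi> = {..<num_agents x}" "justified (profiles x ! j) p \<pi>"
    by (rule pareto_optimal_order[OF jl L(3)[OF j]])
  let ?q = "assoc_fun (serial_dictatorship (profiles x ! j) \<pi>)"
  have "?q a = p a" if "a < num_agents x" for a
    using that \<pi>(2) assignment_serial_dictatorship(2)[OF jl \<pi>(1,2)]
    by (intro assoc_fun_eq) (auto simp: serial_dictatorship_justified[OF \<pi>(3)])
  then have "pareto_optimal x j' ?q = pareto_optimal x j' p" for j'
    by (rule pareto_optimal_cong)
  then have "alpha x \<le> card {j'. j' < num_layers x \<and> pareto_optimal x j' ?q}"
    unfolding L(2)[symmetric] using L by (intro card_mono) auto
  then show "\<exists>\<pi>. distinct \<pi> \<and> set \<pi> = {..<num_agents x} \<and> order_test x \<pi>"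
    using order_test_iff[OF \<pi>(1,2)] \<pi>(1,2) jl by blast
next
  assume "\<exists>\<pi>. distinct \<pi> \<and> set \<pi> = {..<num_agents x} \<and> order_test x \<pi>"
  then obtain \<pi> j where \<pi>: "distinct \<pi>" "set \<pi> = {..<num_agents x}" and j: "j < num_layers x"
    and le: "alpha x \<le> card {j'. j' < num_layers x \<and>
      pareto_optimal x j' (assoc_fun (serial_dictatorship (profiles x ! j) \<pi>))}"
    using order_test_iff by blast
  \<comment> \<open>The test counts at least \<open>alpha x\<close> layers, whereas
    \<open>globally_optimal\<close> asks for a set of exactly that many.\<close>
  obtain L where "L \<subseteq> {j'. j' < num_layers x \<and>
      pareto_optimal x j' (assoc_fun (serial_dictatorship (profiles x ! j) \<pi>))}" "card L = alpha x"
    by (rule obtain_subset_with_card_n[OF le])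
  then have "globally_optimal x (assoc_fun (serial_dictatorship (profiles x ! j) \<pi>))"
    unfolding globally_optimal_def
    by (intro conjI exI[of _ L] assignment_serial_dictatorship(1)[OF j \<pi>]) auto
  then show "\<exists>p. globally_optimal x p"
    by blast
qed

end

section \<open>Tree programs\<close>

abbreviation "True_tree \<equiv> Node Leaf Leaf"

definition not_tree :: "tree \<Rightarrow> tree" where
  "not_tree t = (if t = Leaf then True_tree else Leaf)"

definition any_tree :: "(tree \<Rightarrow> tree) \<Rightarrow> tree \<Rightarrow> tree" where
  "any_tree f l = fold_tree (\<lambda>h a. if f h = Leaf then a else True_tree) l Leaf"

text \<open>The wrapper \<open>Node Leaf\<close> distinguishes a found \<open>Leaf\<close>, which
  encodes 0, from finding nothing.\<close>

definition find_tree :: "(tree \<Rightarrow> tree) \<Rightarrow> tree \<Rightarrow> tree" where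
  "find_tree f l =
     fold_tree (\<lambda>h a. if a = Leaf then (if f h = Leaf then Leaf else Node Leaf h) else a) l Leaf"

definition drop_tree :: "tree \<Rightarrow> tree \<Rightarrow> tree" where
  "drop_tree k l = fold_tree (\<lambda>_ a. tail a) k l"

definition nth_tree :: "tree \<Rightarrow> tree \<Rightarrow> tree" where
  "nth_tree l k = head (drop_tree k l)"

text \<open>On unary numbers \<open>drop_tree\<close> is truncated subtraction; two numbers are
  equal when both differences vanish.\<close>

definition eq_tree :: "tree \<Rightarrow> tree \<Rightarrow> tree" where
  "eq_tree k l = (if drop_tree k l = Leaf then not_tree (drop_tree l k) else Leaf)"

definition rev_tree :: "tree \<Rightarrow> tree" where
  "rev_tree l = fold_tree Node l Leaf"

definition snoc_tree :: "tree \<Rightarrow> tree \<Rightarrow> tree" where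
  "snoc_tree l h = rev_tree (Node h (rev_tree l))"

definition rotate_tree :: "tree \<Rightarrow> tree \<Rightarrow> tree" where
  "rotate_tree k l = fold_tree (\<lambda>_ a. snoc_tree (tail a) (head a)) k l"

text \<open>The accumulator serves as its own counter: after \<open>i\<close> rounds its spine has
  length \<open>i\<close>, and the next element is \<open>k - (i + 1)\<close>. The list thus grows
  downwards from \<open>k - 1\<close> to 0.\<close>

definition upt_tree :: "tree \<Rightarrow> tree" where
  "upt_tree k = fold_tree (\<lambda>_ a. Node (drop_tree (Node Leaf a) k) a) k Leaf"

text \<open>\<open>Node Leaf b\<close> is the successor of \<open>b\<close>, the form in which
  entries store items; an entry without an item stores 0 and matches nothing. The wrapper added by
  \<open>find_tree\<close> puts the answer into this form as well.\<close>

definition first_free_tree :: "tree \<Rightarrow> tree \<Rightarrow> tree" where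
  "first_free_tree T l =
     find_tree (\<lambda>b. not_tree (any_tree (\<lambda>e. eq_tree (Node Leaf b) (tail e)) T)) l"

definition dictatorship_tree :: "tree \<Rightarrow> tree \<Rightarrow> tree" where
  "dictatorship_tree P \<pi> =
     fold_tree (\<lambda>a T. Node (Node a (first_free_tree T (nth_tree P a))) T) \<pi> Leaf"

definition settle_pass_tree :: "tree \<Rightarrow> tree \<Rightarrow> tree \<Rightarrow> tree" where
  "settle_pass_tree P ps T = fold_tree (\<lambda>e T.
     if eq_tree (first_free_tree T (nth_tree P (head e))) (tail e) = Leaf then T else Node e T) ps T"

definition settled_tree :: "tree \<Rightarrow> tree \<Rightarrow> tree" where
  "settled_tree P ps = fold_tree (\<lambda>_ T. settle_pass_tree P ps T) ps Leaf"

definition po_test_tree :: "tree \<Rightarrow> tree \<Rightarrow> tree" where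
  "po_test_tree P ps = not_tree (any_tree (\<lambda>e.
     not_tree (any_tree (\<lambda>e'. eq_tree (head e) (head e')) (settled_tree P ps))) ps)"

text \<open>The required number of layers is counted down with \<open>tail\<close>, which stops at
  \<open>Leaf\<close>; \<open>Leaf\<close> is reached exactly if enough layers pass.\<close>

definition order_test_tree :: "tree \<Rightarrow> tree \<Rightarrow> tree \<Rightarrow> tree" where
  "order_test_tree Ps k \<pi> = any_tree (\<lambda>P. not_tree (fold_tree (\<lambda>P' k.
     if po_test_tree P' (dictatorship_tree P \<pi>) = Leaf then k else tail k) Ps k)) Ps"

definition full_digits_tree :: "tree \<Rightarrow> tree" where
  "full_digits_tree l = fold_tree (\<lambda>k a. Node (Node k k) a) l Leaf"

text \<open>Subtraction of one, least significant digit first. The accumulator starts with a pending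
  borrow in its head; a zero digit becomes its maximum and passes the borrow on. A borrow left at
  the end signals that the number was zero. The digits come out reversed.\<close>

definition decrement_tree :: "tree \<Rightarrow> tree" where
  "decrement_tree ds = fold_tree (\<lambda>d s.
     if head s = Leaf then Node Leaf (Node d (tail s))
     else if head d = Leaf then Node (head s) (Node (Node (tail d) (tail d)) (tail s))
     else Node Leaf (Node (Node (tail (head d)) (tail d)) (tail s))) ds (Node True_tree Leaf)"

text \<open>The accumulator pairs the remaining agents with those picked so far, latest first, so
  the order comes out reversed.\<close>

definition pick_tree :: "tree \<Rightarrow> tree \<Rightarrow> tree" where
  "pick_tree R ds = tail (fold_tree (\<lambda>d s. Node (tail (rotate_tree (head d) (head s)))
     (Node (head (rotate_tree (head d) (head s))) (tail s))) ds (Node R Leaf))"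

text \<open>A state consists of the run flag, the counter, the flag for success and the unchanged
  input. Counting down from the largest number lets the borrow announce the end.\<close>

definition init_tree :: "tree \<Rightarrow> tree" where
  "init_tree x = Node True_tree (Node (full_digits_tree (upt_tree (head x))) (Node Leaf x))"

text \<open>Test and decrement both read the old counter, so order 0 is still tested in the round
  that clears the run flag.\<close>

definition step_tree :: "tree \<Rightarrow> tree" where
  "step_tree y =
     Node (not_tree (head (decrement_tree (head (tail y)))))
       (Node (rev_tree (tail (decrement_tree (head (tail y)))))
         (Node (if order_test_tree (head (tail (tail (tail (tail (tail y))))))
             (tail (tail (tail (tail (tail (tail y))))))
             (pick_tree (upt_tree (head (tail (tail (tail y))))) (head (tail y))) = Leaf
           then head (tail (tail y)) else True_tree)
         (tail (tail (tail y)))))"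

subsection \<open>Polynomial time\<close>

lemma nodes_find_tree: "nodes (find_tree f l) \<le> 1 + nodes l * (nodes l + 2)"
proof -
  have "nodes (find_tree f l) \<le> nodes Leaf + nodes l * (nodes l + 2)"
    unfolding find_tree_def by (intro nodes_fold_tree) auto
  then show ?thesis
    by simp
qed

lemma nodes_drop_tree: "nodes (drop_tree k l) \<le> nodes l"
proof -
  have "nodes (drop_tree k l) \<le> nodes l + nodes k * 0"
    unfolding drop_tree_def by (intro nodes_fold_tree) (simp add: nodes_tail)
  then show ?thesis
    by simp
qed

lemma nodes_nth_tree: "nodes (nth_tree l k) \<le> nodes l"
  unfolding nth_tree_def using nodes_head nodes_drop_tree by (rule le_trans)

text \<open>The bound must not involve \<open>T\<close>, which is the accumulator of
  \<open>dictatorship_tree\<close>: an entry may only add an amount independent of it.\<close>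

lemma nodes_first_free_nth:
  "nodes (first_free_tree T (nth_tree P a)) \<le> 1 + nodes P * (nodes P + 2)"
proof -
  have "nodes (nth_tree P a) * (nodes (nth_tree P a) + 2) \<le> nodes P * (nodes P + 2)"
    by (intro mult_le_mono add_le_mono nodes_nth_tree order_refl)
  then show ?thesis
    using nodes_find_tree[of _ "nth_tree P a"] unfolding first_free_tree_def
    by (meson add_left_mono le_trans)
qed

lemma nodes_settle_pass_tree:
  "nodes (settle_pass_tree P ps T) \<le> nodes T + nodes ps * (nodes ps + 1)"
  unfolding settle_pass_tree_def by (intro nodes_fold_tree) auto

lemma nodes_fold_tree_Node: "nodes (fold_tree Node l a) + 1 = nodes l + nodes a"
  by (induction l arbitrary: a) auto

lemma nodes_rev_tree: "nodes (rev_tree l) = nodes l"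
  using nodes_fold_tree_Node[of l Leaf] by (simp add: rev_tree_def)

lemma nodes_snoc_tree: "nodes (snoc_tree l h) = nodes l + nodes h + 1"
  by (simp add: snoc_tree_def nodes_rev_tree)

text \<open>Rotation preserves the size of a nonempty list. The 2 pays for the degenerate step from
  \<open>Leaf\<close> to \<open>Node Leaf Leaf\<close>.\<close>

lemma nodes_rotate_tree: "nodes (rotate_tree k l) \<le> nodes l + nodes k * 2"
  unfolding rotate_tree_def
proof (rule nodes_fold_tree)
  show "nodes (snoc_tree (tail a) (head a)) \<le> nodes a + 2" for a
    by (cases a) (simp_all add: nodes_snoc_tree)
qed

lemma nodes_head_tail: "nodes (head t) + nodes (tail t) \<le> nodes t + 1"
  by (cases t) auto

text \<open>The first premise is polynomial time for a function of two trees, in the packed form in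
  which the fold rules receive their bodies.\<close>

lemma ptime_comp2:
  assumes "ptime (\<lambda>y. F (head y) (tail y))" "ptime f" "ptime g"
  shows "ptime (\<lambda>x. F (f x) (g x))"
  using ptime_comp[OF assms(1) ptime_Node[OF assms(2,3)]] by simp

lemmas ptime_intros = ptime_Leaf ptime_id ptime_head ptime_tail ptime_Node ptime_If

section \<open>Closure rules for the programs of one round\<close>

lemma ptime_not_tree: "ptime f \<Longrightarrow> ptime (\<lambda>x. not_tree (f x))"
  unfolding not_tree_def by (intro ptime_intros)

lemma ptime_any_tree:
  assumes F: "ptime (\<lambda>y. F (head y) (tail y))" and L: "ptime L"
  shows "ptime (\<lambda>x. any_tree (F x) (L x))"
  unfolding any_tree_def
  by (rule ptime_fold_tree[where q = "\<lambda>x h. 3"])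
    (intro ptime_intros ptime_comp2[of F, OF F] L poly_bounded_intros | simp)+

lemma ptime_find_tree:
  assumes F: "ptime (\<lambda>y. F (head y) (tail y))" and L: "ptime L"
  shows "ptime (\<lambda>x. find_tree (F x) (L x))"
  unfolding find_tree_def
  by (rule ptime_fold_tree[where q = "\<lambda>x h. nodes h + 2"])
    (intro ptime_intros ptime_comp2[of F, OF F] L poly_bounded_intros poly_bounded_ptime | simp)+

lemma ptime_drop_tree: "ptime f \<Longrightarrow> ptime g \<Longrightarrow> ptime (\<lambda>x. drop_tree (f x) (g x))"
  unfolding drop_tree_def
  by (rule ptime_fold_tree[where q = "\<lambda>x h. 0"])
    (assumption | intro ptime_intros poly_bounded_intros | simp add: nodes_tail)+

lemma ptime_nth_tree: "ptime f \<Longrightarrow> ptime g \<Longrightarrow> ptime (\<lambda>x. nth_tree (f x) (g x))"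
  unfolding nth_tree_def by (intro ptime_intros ptime_drop_tree)

lemma ptime_eq_tree: "ptime f \<Longrightarrow> ptime g \<Longrightarrow> ptime (\<lambda>x. eq_tree (f x) (g x))"
  unfolding eq_tree_def by (intro ptime_intros ptime_drop_tree ptime_not_tree)

lemma ptime_rev_tree: "ptime f \<Longrightarrow> ptime (\<lambda>x. rev_tree (f x))"
  unfolding rev_tree_def
  by (rule ptime_fold_tree[where q = "\<lambda>x h. nodes h + 1"])
    (assumption | intro ptime_intros poly_bounded_intros poly_bounded_ptime | simp)+

lemma ptime_snoc_tree: "ptime f \<Longrightarrow> ptime g \<Longrightarrow> ptime (\<lambda>x. snoc_tree (f x) (g x))"
  unfolding snoc_tree_def by (intro ptime_intros ptime_rev_tree)

lemma ptime_rotate_tree: "ptime f \<Longrightarrow> ptime g \<Longrightarrow> ptime (\<lambda>x. rotate_tree (f x) (g x))"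
  unfolding rotate_tree_def
proof (rule ptime_fold_tree[where q = "\<lambda>x h. 2"])
  show "nodes (snoc_tree (tail a) (head a)) \<le> nodes a + 2" for a
    by (cases a) (simp_all add: nodes_snoc_tree)
qed (assumption | intro ptime_intros ptime_snoc_tree poly_bounded_intros)+

lemma ptime_upt_tree:
  assumes f: "ptime f"
  shows "ptime (\<lambda>x. upt_tree (f x))"
  unfolding upt_tree_def
proof (rule ptime_fold_tree[where q = "\<lambda>x h. nodes (f x) + 1"])
  show "nodes (Node (drop_tree (Node Leaf a) (f x)) a) \<le> nodes a + (nodes (f x) + 1)" for a x
    using nodes_drop_tree[of "Node Leaf a" "f x"] by simp
qed (intro ptime_intros ptime_drop_tree ptime_comp[OF f] f poly_bounded_intros poly_bounded_ptime)+

lemma ptime_first_free_tree: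
  assumes f: "ptime f" and g: "ptime g"
  shows "ptime (\<lambda>x. first_free_tree (f x) (g x))"
  unfolding first_free_tree_def
  by (intro ptime_find_tree ptime_any_tree ptime_not_tree ptime_eq_tree ptime_intros
    ptime_comp[OF f] ptime_comp[OF g])

lemma ptime_dictatorship_tree:
  assumes f: "ptime f" and g: "ptime g"
  shows "ptime (\<lambda>x. dictatorship_tree (f x) (g x))"
  unfolding dictatorship_tree_def
proof (rule ptime_fold_tree[where q = "\<lambda>x h. nodes h + nodes (f x) * (nodes (f x) + 2) + 3"])
  show "nodes (Node (Node h (first_free_tree a (nth_tree (f x) h))) a) \<le>
      nodes a + (nodes h + nodes (f x) * (nodes (f x) + 2) + 3)" for x h a
    using nodes_first_free_nth[of a "f x" h] unfolding nodes.simps by linarith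
qed (intro ptime_first_free_tree ptime_nth_tree ptime_intros ptime_comp[OF f] g
  poly_bounded_intros poly_bounded_ptime)+

lemma ptime_settle_pass_tree:
  assumes f: "ptime f" and g: "ptime g" and h: "ptime h"
  shows "ptime (\<lambda>x. settle_pass_tree (f x) (g x) (h x))"
  unfolding settle_pass_tree_def
  by (rule ptime_fold_tree[where q = "\<lambda>x h. nodes h + 1"])
    (intro ptime_first_free_tree ptime_nth_tree ptime_eq_tree ptime_intros ptime_comp[OF f] g h
      poly_bounded_intros poly_bounded_ptime | simp)+

lemma ptime_settled_tree:
  assumes f: "ptime f" and g: "ptime g"
  shows "ptime (\<lambda>x. settled_tree (f x) (g x))"
  unfolding settled_tree_def
  by (rule ptime_fold_tree[where q = "\<lambda>x h. nodes (g x) * (nodes (g x) + 1)"])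
    (intro ptime_settle_pass_tree ptime_intros ptime_comp[OF f] ptime_comp[OF g] g
      poly_bounded_intros poly_bounded_ptime nodes_settle_pass_tree)+

lemma ptime_po_test_tree:
  assumes f: "ptime f" and g: "ptime g"
  shows "ptime (\<lambda>x. po_test_tree (f x) (g x))"
  unfolding po_test_tree_def
  by (intro ptime_any_tree ptime_not_tree ptime_eq_tree ptime_settled_tree ptime_intros
    ptime_comp[OF f] ptime_comp[OF g])

lemma ptime_order_test_tree:
  assumes f: "ptime f" and g: "ptime g" and h: "ptime h"
  shows "ptime (\<lambda>x. order_test_tree (f x) (g x) (h x))"
  unfolding order_test_tree_def
proof (intro ptime_any_tree ptime_not_tree f)
  show "ptime (\<lambda>y. fold_tree (\<lambda>P' k. if po_test_tree P' (dictatorship_tree (tail y) (h (head y))) = Leaf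
      then k else tail k) (f (head y)) (g (head y)))"
    by (rule ptime_fold_tree[where q = "\<lambda>x h. 0"])
      (intro ptime_po_test_tree ptime_dictatorship_tree ptime_intros ptime_comp[OF f]
        ptime_comp[OF g] ptime_comp[OF h] poly_bounded_intros | simp add: nodes_tail)+
qed

lemma ptime_full_digits_tree: "ptime f \<Longrightarrow> ptime (\<lambda>x. full_digits_tree (f x))"
  unfolding full_digits_tree_def
  by (rule ptime_fold_tree[where q = "\<lambda>x h. 2 * nodes h + 2"])
    (assumption | intro ptime_intros poly_bounded_intros poly_bounded_ptime | simp)+

lemma ptime_decrement_tree: "ptime f \<Longrightarrow> ptime (\<lambda>x. decrement_tree (f x))"
  unfolding decrement_tree_def
proof (rule ptime_fold_tree[where q = "\<lambda>x h. 2 * nodes h + 10"], assumption)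
  show "nodes (if head s = Leaf then Node Leaf (Node d (tail s))
     else if head d = Leaf then Node (head s) (Node (Node (tail d) (tail d)) (tail s))
     else Node Leaf (Node (Node (tail (head d)) (tail d)) (tail s))) \<le> nodes s + (2 * nodes d + 10)" for d s
    using nodes_head_tail[of s] nodes_tail[of s] nodes_tail[of d] nodes_tail[of "head d"] nodes_head[of d]
    by auto
qed (assumption | intro ptime_intros poly_bounded_intros poly_bounded_ptime)+

lemma ptime_pick_tree:
  assumes f: "ptime f" and g: "ptime g"
  shows "ptime (\<lambda>x. pick_tree (f x) (g x))"
  unfolding pick_tree_def
proof (rule ptime_tail, rule ptime_fold_tree[where q = "\<lambda>x h. nodes h * 2 + 10"])
  show "nodes (Node (tail (rotate_tree (head d) (head s)))
     (Node (head (rotate_tree (head d) (head s))) (tail s))) \<le> nodes s + (nodes d * 2 + 10)" for d s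
    using nodes_head_tail[of "rotate_tree (head d) (head s)"] nodes_rotate_tree[of "head d" "head s"]
      nodes_head[of d] nodes_head_tail[of s] unfolding nodes.simps by linarith
qed (intro ptime_rotate_tree ptime_intros f g poly_bounded_intros poly_bounded_ptime)+

lemma ptime_init_tree: "ptime init_tree"
  unfolding init_tree_def[abs_def] by (intro ptime_full_digits_tree ptime_upt_tree ptime_intros)

lemma ptime_step_tree: "ptime step_tree"
  unfolding step_tree_def[abs_def]
  by (intro ptime_not_tree ptime_decrement_tree ptime_rev_tree ptime_order_test_tree ptime_pick_tree
    ptime_upt_tree ptime_intros)

subsection \<open>Correctness\<close>

lemma not_tree_eq_Leaf [simp]: "not_tree t = Leaf \<longleftrightarrow> t \<noteq> Leaf"
  by (simp add: not_tree_def)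

section \<open>Encoded numbers and lists\<close>

lemma encode_list_const: "encode_list (\<lambda>_. Leaf) xs = (Node Leaf ^^ length xs) Leaf"
  by (induction xs) auto

lemma encode_nat_simps [simp]:
  "encode_nat 0 = Leaf" "encode_nat (Suc k) = Node Leaf (encode_nat k)"
  by (simp_all add: encode_nat_def encode_list_const)

lemma encode_nat_eq_Leaf [simp]: "encode_nat k = Leaf \<longleftrightarrow> k = 0"
  by (cases k) auto

lemma tail_encode_nat [simp]: "tail (encode_nat k) = encode_nat (k - 1)"
  by (cases k) auto

lemma tail_encode_list [simp]: "tail (encode_list e xs) = encode_list e (tl xs)"
  by (cases xs) auto

lemma head_encode_list [simp]: "xs \<noteq> [] \<Longrightarrow> head (encode_list e xs) = e (hd xs)"
  by (cases xs) auto

lemma fold_tree_encode_list [simp]: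
  "fold_tree g (encode_list e xs) a = fold (\<lambda>x. g (e x)) xs a"
  by (induction xs arbitrary: a) auto

lemma fold_tree_encode_nat [simp]: "fold_tree g (encode_nat k) a = (g Leaf ^^ k) a"
  by (induction k arbitrary: a) (simp_all add: funpow_swap1)

lemma fold_encode:
  assumes "\<And>x a. x \<in> set xs \<Longrightarrow> g x (c a) = c (h x a)"
  shows "fold g xs (c a) = c (fold h xs a)"
  using assms by (induction xs arbitrary: a) auto

lemma fold_tail: "fold (\<lambda>_. tail) xs t = (tail ^^ length xs) t"
  by (induction xs arbitrary: t) (simp_all add: funpow_swap1)

lemma tail_funpow_nat: "(tail ^^ k) (encode_nat m) = encode_nat (m - k)"
  by (induction k) simp_all

lemma tail_funpow_list: "(tail ^^ k) (encode_list e xs) = encode_list e (drop k xs)"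
  by (induction k) (simp_all add: drop_Suc tl_drop)

lemma any_tree_eq_Leaf [simp]:
  "any_tree f (encode_list e xs) = Leaf \<longleftrightarrow> (\<forall>x \<in> set xs. f (e x) = Leaf)"
proof -
  have "fold (\<lambda>x a. if f (e x) = Leaf then a else True_tree) xs t = Leaf \<longleftrightarrow>
      t = Leaf \<and> (\<forall>x \<in> set xs. f (e x) = Leaf)" for t
    by (induction xs arbitrary: t) auto
  then show ?thesis
    by (simp add: any_tree_def)
qed

lemma find_tree_encode_list:
  "find_tree f (encode_list e xs) =
    (case find (\<lambda>x. f (e x) \<noteq> Leaf) xs of None \<Rightarrow> Leaf | Some x \<Rightarrow> Node Leaf (e x))"
proof -
  let ?g = "\<lambda>x a. if a = Leaf then (if f (e x) = Leaf then Leaf else Node Leaf (e x)) else a"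
  have 1: "fold ?g xs t = t" if "t \<noteq> Leaf" for xs t
    using that by (induction xs) auto
  have "fold ?g xs Leaf =
      (case find (\<lambda>x. f (e x) \<noteq> Leaf) xs of None \<Rightarrow> Leaf | Some x \<Rightarrow> Node Leaf (e x))"
    by (induction xs) (auto simp: 1)
  then show ?thesis
    by (simp add: find_tree_def)
qed

lemma eq_tree_eq_Leaf [simp]: "eq_tree (encode_nat k) (encode_nat l) = Leaf \<longleftrightarrow> k \<noteq> l"
  by (auto simp: eq_tree_def drop_tree_def tail_funpow_nat)

lemma nth_tree_encode [simp]:
  "k < length xs \<Longrightarrow> nth_tree (encode_list e xs) (encode_nat k) = e (xs ! k)"
  by (simp add: nth_tree_def drop_tree_def tail_funpow_list hd_drop_conv_nth)

lemma fold_Node_encode: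
  "fold (\<lambda>x. Node (e x)) xs (encode_list e ys) = encode_list e (rev xs @ ys)"
  by (induction xs arbitrary: ys) (auto simp flip: encode_list.simps)

lemma rev_tree_encode [simp]: "rev_tree (encode_list e xs) = encode_list e (rev xs)"
  using fold_Node_encode[of e xs "[]"] by (simp add: rev_tree_def)

lemma snoc_tree_encode: "snoc_tree (encode_list e xs) (e y) = encode_list e (xs @ [y])"
  by (simp add: snoc_tree_def flip: encode_list.simps)

lemma rotate_tree_encode [simp]:
  assumes "xs \<noteq> []"
  shows "rotate_tree (encode_nat k) (encode_list e xs) = encode_list e (rotate k xs)"
proof -
  have "((\<lambda>a. snoc_tree (tail a) (head a)) ^^ k) (encode_list e xs) = encode_list e (rotate k xs)"
  proof (induction k)
    case (Suc k)
    have ne: "rotate k xs \<noteq> []"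
      using assms by simp
    then show ?case
      by (simp add: Suc snoc_tree_encode rotate1_hd_tl)
  qed simp
  then show ?thesis
    by (simp add: rotate_tree_def)
qed

lemma upt_tree_encode [simp]: "upt_tree (encode_nat m) = encode_list encode_nat [0..<m]"
proof -
  have "((\<lambda>a. Node (drop_tree (Node Leaf a) (encode_nat m)) a) ^^ k) Leaf =
      encode_list encode_nat [m - k..<m]" if "k \<le> m" for k
    using that
  proof (induction k)
    case (Suc k)
    then have "[m - Suc k..<m] = (m - Suc k) # [m - k..<m]"
      by (simp add: upt_conv_Cons Suc_diff_Suc)
    then show ?case
      using Suc by (simp add: drop_tree_def fold_tail tail_funpow_nat)
  qed simp
  then show ?thesis
    by (simp add: upt_tree_def)
qed

text \<open>Assigned items are shifted by one so that \<open>0\<close> can encode \<open>None\<close>.\<close>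

definition encode_entry :: "nat \<times> nat option \<Rightarrow> tree" where
  "encode_entry e = Node (encode_nat (fst e)) (encode_nat (case_option 0 Suc (snd e)))"

lemma head_tail_encode_entry [simp]:
  "head (encode_entry e) = encode_nat (fst e)"
  "tail (encode_entry e) = encode_nat (case_option 0 Suc (snd e))"
  by (simp_all add: encode_entry_def)

lemma case_option_Suc_eq: "case_option 0 Suc u = case_option 0 Suc v \<longleftrightarrow> u = v"
  by (auto split: option.splits)

abbreviation "encode_layer \<equiv> encode_list (encode_list encode_nat)"

lemma first_free_tree_encode [simp]:
  "first_free_tree (encode_list encode_entry T) (encode_list encode_nat l) =
    encode_nat (case_option 0 Suc (first_free T l))"
proof -
  have "Suc b = case_option 0 Suc u \<longleftrightarrow> Some b = u" for b u
    by (auto split: option.splits)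
  then have "(\<forall>e \<in> set T. Suc b \<noteq> case_option 0 Suc (snd e)) \<longleftrightarrow> Some b \<notin> snd ` set T" for b
    by auto
  then show ?thesis
    by (simp add: first_free_tree_def find_tree_encode_list first_free_def
      split: option.splits flip: encode_nat_simps(2))
qed

lemma dictatorship_tree_encode [simp]:
  assumes "set \<pi> \<subseteq> {..<length P}"
  shows "dictatorship_tree (encode_layer P) (encode_list encode_nat \<pi>) =
    encode_list encode_entry (serial_dictatorship P \<pi>)"
  unfolding dictatorship_tree_def serial_dictatorship_def fold_tree_encode_list
  using assms
  \<comment> \<open>The initial \<open>Leaf\<close> has to be read as the encoding of the empty list
    before the fold can be moved through the encoding.\<close>
  by (subst encode_list.simps(1)[of encode_entry, symmetric], intro fold_encode)
    (auto simp: encode_entry_def[of "(a, u)" for a u])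

lemma settle_pass_tree_encode [simp]:
  assumes "fst ` set ps \<subseteq> {..<length P}"
  shows "settle_pass_tree (encode_layer P) (encode_list encode_entry ps) (encode_list encode_entry T) =
    encode_list encode_entry (settle_pass P ps T)"
  unfolding settle_pass_tree_def settle_pass_def fold_tree_encode_list
  using assms
  by (intro fold_encode) (auto simp: case_option_Suc_eq)

lemma settled_tree_encode [simp]:
  assumes "fst ` set ps \<subseteq> {..<length P}"
  shows "settled_tree (encode_layer P) (encode_list encode_entry ps) =
    encode_list encode_entry (settled P ps)"
  unfolding settled_tree_def settled_def fold_tree_encode_list
  using assms
  by (subst encode_list.simps(1)[of encode_entry, symmetric], intro fold_encode) auto

lemma po_test_tree_eq_Leaf [simp]:
  assumes "fst ` set ps \<subseteq> {..<length P}"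
  shows "po_test_tree (encode_layer P) (encode_list encode_entry ps) = Leaf \<longleftrightarrow> \<not> po_test P ps"
  using assms by (auto simp: po_test_tree_def po_test_def)

lemma order_test_tree_eq_Leaf:
  assumes x: "goa_instance x" and \<pi>: "set \<pi> \<subseteq> {..<num_agents x}"
  shows "order_test_tree (encode_list encode_layer (profiles x)) (encode_nat (alpha x))
    (encode_list encode_nat \<pi>) = Leaf \<longleftrightarrow> \<not> order_test x \<pi>"
proof -
  have len: "length P = num_agents x" if "P \<in> set (profiles x)" for P
    using x that unfolding goa_instance_def num_layers_def by (auto simp: in_set_conv_nth)
  have "fold (\<lambda>P' k. if po_test_tree (encode_layer P')
        (dictatorship_tree (encode_layer P) (encode_list encode_nat \<pi>)) = Leaf then k else tail k)
        Ps (encode_nat k) =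
      encode_nat (k - length (filter (\<lambda>P'. po_test P' (serial_dictatorship P \<pi>)) Ps))"
    if P: "P \<in> set (profiles x)" and Ps: "set Ps \<subseteq> set (profiles x)" for P Ps k
    using Ps
  proof (induction Ps arbitrary: k)
    case (Cons P' Ps)
    have "fst ` set (serial_dictatorship P \<pi>) \<subseteq> {..<length P'}"
      using arg_cong[OF fst_serial_dictatorship[of P \<pi>], of set] \<pi> len Cons.prems by simp
    then show ?case
      using Cons \<pi> len[OF P] by simp
  qed simp
  then show ?thesis
    by (auto simp: order_test_tree_def order_test_def)
qed

text \<open>Orders of the agents are counted in a mixed radix system, an entry \<open>(c, L)\<close> being a digit
  \<open>c \<le> L\<close>; the digit tells how far to rotate the list of remaining agents before taking its head.\<close>

fun digits :: "nat \<Rightarrow> nat list \<Rightarrow> (nat \<times> nat) list" where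
  "digits i [] = []"
| "digits i (L # Ls) = (i mod Suc L, L) # digits (i div Suc L) Ls"

fun pick :: "nat list \<Rightarrow> (nat \<times> nat) list \<Rightarrow> nat list" where
  "pick R [] = []"
| "pick R (d # ds) = hd (rotate (fst d) R) # pick (tl (rotate (fst d) R)) ds"

lemma length_digits [simp]: "length (digits i Ls) = length Ls"
  by (induction Ls arbitrary: i) auto

lemma pick_permutation:
  assumes "length R = length ds" "distinct R"
  shows "distinct (pick R ds) \<and> set (pick R ds) = set R"
  using assms
proof (induction ds arbitrary: R)
  case (Cons d ds)
  obtain a R' where R': "rotate (fst d) R = a # R'"
    using Cons.prems(1) by (cases "rotate (fst d) R") (auto dest: arg_cong[of _ _ length])
  have "length (a # R') = length R" "distinct (a # R')" "set (a # R') = set R"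
    using Cons.prems(2) by (simp_all flip: R')
  then show ?case
    using Cons.IH[of R'] Cons.prems(1) by (auto simp: R')
qed simp

text \<open>The least significant digit is the position of the first agent of the order among all
  candidates; the quotient numbers the rest of the order. The radix of each digit is the number of
  agents still available.\<close>

lemma pick_surj:
  assumes "distinct R" "distinct \<pi>" "set \<pi> = set R" "length R = m"
  shows "\<exists>i < fact m. pick R (digits i (rev [0..<m])) = \<pi>"
  using assms
proof (induction m arbitrary: R \<pi>)
  case (Suc m)
  have "length \<pi> = Suc m"
    using Suc.prems distinct_card[of R] distinct_card[of \<pi>] by simp
  then obtain a \<pi>' where \<pi>': "\<pi> = a # \<pi>'"
    by (cases \<pi>) auto
  have "a \<in> set R"
    using Suc.prems(3) \<pi>' by auto
  then obtain c where c: "c < Suc m" "R ! c = a"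
    using Suc.prems(4) by (auto simp: in_set_conv_nth)
  have "R \<noteq> []"
    using Suc.prems(4) by auto
  then have hd: "hd (rotate c R) = a"
    using c Suc.prems(4) by (simp add: hd_rotate_conv_nth)
  obtain R' where R': "rotate c R = a # R'"
    using hd \<open>R \<noteq> []\<close> by (cases "rotate c R") auto
  have R'_facts: "length (a # R') = length R" "distinct (a # R')" "set (a # R') = set R"
    using Suc.prems(1) by (simp_all flip: R')
  have "distinct R'" "distinct \<pi>'" "set \<pi>' = set R'" "length R' = m"
    using R'_facts Suc.prems \<pi>' by auto
  then obtain i where i: "i < fact m" "pick R' (digits i (rev [0..<m])) = \<pi>'"
    using Suc.IH by blast
  let ?i = "c + Suc m * i"
  have "?i < Suc m * Suc i"
    using c(1) by simp
  also have "\<dots> \<le> Suc m * fact m"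
    using i(1) by (intro mult_le_mono2) simp
  finally have "?i < fact (Suc m)"
    by simp
  moreover have "?i mod Suc m = c" "?i div Suc m = i"
    using c(1) by (simp_all del: mult_Suc)
  ultimately show ?case
    using i(2) R' \<pi>' by (intro exI[of _ ?i]) (simp del: mult_Suc)
qed simp

definition encode_digit :: "nat \<times> nat \<Rightarrow> tree" where
  "encode_digit d = Node (encode_nat (fst d)) (encode_nat (snd d))"

abbreviation "encode_digits \<equiv> encode_list encode_digit"

lemma head_tail_encode_digit [simp]:
  "head (encode_digit d) = encode_nat (fst d)" "tail (encode_digit d) = encode_nat (snd d)"
  by (simp_all add: encode_digit_def)

text \<open>In the factorial number system the largest number has all digits maximal.\<close>

lemma digits_full: "digits (fact m - 1) (rev [0..<m]) = rev (map (\<lambda>k. (k, k)) [0..<m])"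
proof (induction m)
  case (Suc m)
  have "fact (Suc m) - 1 = m + Suc m * (fact m - 1)"
    by (cases "fact m :: nat") simp_all
  moreover have "(m + Suc m * (fact m - 1)) mod Suc m = m" "(m + Suc m * (fact m - 1)) div Suc m = fact m - 1"
    by (simp_all del: mult_Suc)
  ultimately have "digits (fact (Suc m) - 1) (m # rev [0..<m]) = (m, m) # digits (fact m - 1) (rev [0..<m])"
    by (simp only: digits.simps)
  then show ?case
    using Suc by simp
qed simp

lemma full_digits_tree_encode:
  "full_digits_tree (encode_list encode_nat [0..<m]) = encode_digits (digits (fact m - 1) (rev [0..<m]))"
proof -
  have "fold (\<lambda>k a. Node (Node (encode_nat k) (encode_nat k)) a) xs (encode_digits ys) =
      encode_digits (rev (map (\<lambda>k. (k, k)) xs) @ ys)" for xs ys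
  proof (induction xs arbitrary: ys)
    case (Cons k xs)
    show ?case
      using Cons.IH[of "(k, k) # ys"] by (simp add: encode_digit_def)
  qed simp
  from this[of _ "[]"] show ?thesis
    by (simp add: full_digits_tree_def digits_full[unfolded One_nat_def])
qed

text \<open>The range bound makes the quotient after the last digit zero. Hence a borrow that
  survives all digits means \<open>i = 0\<close>.\<close>

lemma decrement_tree_encode:
  assumes "i < prod_list (map Suc Ls)"
  defines "r \<equiv> decrement_tree (encode_digits (digits i Ls))"
  shows "i = 0 \<Longrightarrow> head r \<noteq> Leaf"
    and "0 < i \<Longrightarrow> head r = Leaf \<and> rev_tree (tail r) = encode_digits (digits (i - 1) Ls)"
proof -
  let ?g = "\<lambda>d s. if head s = Leaf then Node Leaf (Node d (tail s))
     else if head d = Leaf then Node (head s) (Node (Node (tail d) (tail d)) (tail s))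
     else Node Leaf (Node (Node (tail (head d)) (tail d)) (tail s))"
  \<comment> \<open>Once the borrow has been absorbed, the higher digits are merely copied in
    reverse.\<close>
  have no_borrow: "fold (\<lambda>d. ?g (encode_digit d)) ds (Node Leaf (encode_digits out)) =
      Node Leaf (encode_digits (rev ds @ out))" for ds out
    by (induction ds arbitrary: out) (auto simp flip: encode_list.simps)
  have "fold (\<lambda>d. ?g (encode_digit d)) (digits i Ls) (Node True_tree (encode_digits out)) =
      Node (if i = 0 then True_tree else Leaf) (encode_digits
        (rev (if i = 0 then map (\<lambda>L. (L, L)) Ls else digits (i - 1) Ls) @ out))" for out
    using assms(1)
  proof (induction Ls arbitrary: i out)
    case (Cons L Ls)
    show ?case
    proof (cases "i mod Suc L = 0")
      case True
      then obtain k where k: "i = Suc L * k"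
        by auto
      have IH: "fold (\<lambda>d. ?g (encode_digit d)) (digits k Ls) (Node True_tree (encode_digits ((L, L) # out))) =
          Node (if k = 0 then True_tree else Leaf) (encode_digits
            (rev (if k = 0 then map (\<lambda>L. (L, L)) Ls else digits (k - 1) Ls) @ (L, L) # out))"
        using Cons.prems by (intro Cons.IH) (simp add: k del: mult_Suc)
      have "digits (i - 1) (L # Ls) = (L, L) # digits (k - 1) Ls" if "k > 0"
      proof -
        have "i - 1 = L + Suc L * (k - 1)"
          using that by (cases k) (simp_all add: k)
        moreover have "(L + Suc L * (k - 1)) mod Suc L = L" "(L + Suc L * (k - 1)) div Suc L = k - 1"
          by (simp_all del: mult_Suc)
        ultimately show ?thesis
          by (simp only: digits.simps)
      qed
      moreover have "digits i (L # Ls) = (0, L) # digits k Ls"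
        by (simp add: k del: mult_Suc)
      moreover have "?g (encode_digit (0, L)) (Node True_tree (encode_digits out)) =
          Node True_tree (encode_digits ((L, L) # out))"
        by (simp add: encode_digit_def)
      ultimately show ?thesis
        using IH by (auto simp: k simp del: mult_Suc digits.simps encode_list.simps)
    next
      case False
      then have i: "i > 0"
        by (cases i) auto
      have "(i - 1) div Suc L = i div Suc L" "(i - 1) mod Suc L = i mod Suc L - 1"
        using False i by (cases i; simp add: div_Suc mod_Suc split: if_splits)+
      then have "digits (i - 1) (L # Ls) = (i mod Suc L - 1, L) # digits (i div Suc L) Ls"
        by simp
      moreover have "?g (encode_digit (i mod Suc L, L)) (Node True_tree (encode_digits out)) =
          Node Leaf (encode_digits ((i mod Suc L - 1, L) # out))"
        using False by (simp add: encode_digit_def)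
      ultimately show ?thesis
        using i by (simp add: no_borrow del: encode_list.simps)
    qed
  qed simp
  from this[of "[]"] have r: "r = Node (if i = 0 then True_tree else Leaf) (encode_digits
        (rev (if i = 0 then map (\<lambda>L. (L, L)) Ls else digits (i - 1) Ls)))"
    unfolding r_def decrement_tree_def by simp
  show "i = 0 \<Longrightarrow> head r \<noteq> Leaf"
    "0 < i \<Longrightarrow> head r = Leaf \<and> rev_tree (tail r) = encode_digits (digits (i - 1) Ls)"
    by (auto simp: r)
qed

lemma pick_tree_encode:
  assumes "length R = length ds"
  shows "pick_tree (encode_list encode_nat R) (encode_digits ds) = encode_list encode_nat (rev (pick R ds))"
proof -
  let ?g = "\<lambda>d s. Node (tail (rotate_tree (head d) (head s)))
     (Node (head (rotate_tree (head d) (head s))) (tail s))"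
  have "fold (\<lambda>d. ?g (encode_digit d)) ds (Node (encode_list encode_nat R) (encode_list encode_nat out)) =
      Node Leaf (encode_list encode_nat (rev (pick R ds) @ out))" for out
    using assms
  proof (induction ds arbitrary: R out)
    case (Cons d ds)
    have "R \<noteq> []"
      using Cons.prems by auto
    then show ?case
      using Cons.IH[of "tl (rotate (fst d) R)" "hd (rotate (fst d) R) # out"] Cons.prems by simp
  qed simp
  from this[of "[]"] show ?thesis
    by (simp add: pick_tree_def)
qed

section \<open>Searching all orders\<close>

text \<open>\<open>2 + nodes\<close> is the charge of the loop test, and \<open>D\<close> bounds a
  test together with a round; \<open>m + 1\<close> accounts for the failing test.\<close>

lemma exec_While_funpow:
  assumes step: "\<And>s. \<exists>t s'. exec c s t s' \<and> s' 0 = f (s 0) \<and> t \<le> T (s 0)"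
    and "\<And>i. i < m \<Longrightarrow> head ((f ^^ i) (s 0)) \<noteq> Leaf" "head ((f ^^ m) (s 0)) = Leaf"
    and "\<And>i. i \<le> m \<Longrightarrow> 2 + nodes ((f ^^ i) (s 0)) + T ((f ^^ i) (s 0)) \<le> D"
  shows "\<exists>t s'. exec (While (HeadE (Var 0)) c) s t s' \<and> s' 0 = (f ^^ m) (s 0) \<and> t \<le> (m + 1) * D"
  using assms(2-)
proof (induction m arbitrary: s)
  case 0
  then have "exec (While (HeadE (Var 0)) c) s (1 + charge (HeadE (Var 0)) s) s"
    by (intro exec.WhileFalse) simp
  then show ?case
    by (rule_tac exI, rule_tac exI, rule_tac conjI, assumption) (use 0(3)[of 0] in auto)
next
  case (Suc m)
  obtain t1 s1 where 1: "exec c s t1 s1" "s1 0 = f (s 0)" "t1 \<le> T (s 0)"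
    using step by blast
  have iter: "(f ^^ i) (s1 0) = (f ^^ Suc i) (s 0)" for i
    by (simp only: 1(2) funpow_Suc_right o_apply)
  have "\<exists>t s'. exec (While (HeadE (Var 0)) c) s1 t s' \<and> s' 0 = (f ^^ m) (s1 0) \<and> t \<le> (m + 1) * D"
    by (rule Suc.IH) (use Suc.prems in \<open>auto simp only: iter Suc_less_eq Suc_le_mono\<close>)
  then obtain t2 s2 where 2: "exec (While (HeadE (Var 0)) c) s1 t2 s2" "s2 0 = (f ^^ Suc m) (s 0)"
      "t2 \<le> (m + 1) * D"
    unfolding iter by blast
  have "eval_expr (HeadE (Var 0)) s \<noteq> Leaf"
    using Suc.prems(1)[of 0] by simp
  from exec.WhileTrue[OF this 1(1) 2(1)] show ?case
    by (rule_tac exI, rule_tac exI, rule_tac conjI, assumption)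
      (use 1(3) 2(2,3) Suc.prems(3)[of 0] in auto)
qed

lemma ptime_exec:
  assumes "ptime f"
  shows "\<exists>c k. \<forall>s. \<exists>t s'. exec c s t s' \<and> s' 0 = f (s 0) \<and> t \<le> (nodes (s 0) + 1) ^ k"
proof -
  obtain c T where c: "poly_bounded T" "runs c 0 f T"
    using assms by (rule ptime_runsE)
  obtain k where "T x \<le> (nodes x + 1) ^ k" for x
    using c(1) unfolding poly_bounded_def by blast
  then have "\<exists>t s'. exec c s t s' \<and> s' 0 = f (s 0) \<and> t \<le> (nodes (s 0) + 1) ^ k" for s
    using runsD[OF c(2), of s] by (meson le_trans)
  then show ?thesis
    by blast
qed

text \<open>The number of rounds may be exponential because every state that is stepped obeys one
  polynomial size bound, so all rounds have a common cost bound. The final state is exempt from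
  \<open>B\<close>: it is one application of \<open>step\<close> away from a bounded state. The
  program and the exponent are fixed before the input and \<open>m\<close>.\<close>

lemma ptime_loop:
  assumes init: "ptime init" and step: "ptime step" and final: "ptime final" and B: "poly_bounded B"
  shows "\<exists>c k. \<forall>s m.
    (\<forall>i < m. head ((step ^^ i) (init (s 0))) \<noteq> Leaf \<and> nodes ((step ^^ i) (init (s 0))) \<le> B (s 0)) \<longrightarrow>
    head ((step ^^ m) (init (s 0))) = Leaf \<longrightarrow>
    (\<exists>t s'. exec c s t s' \<and> s' 0 = final ((step ^^ m) (init (s 0))) \<and>
      t \<le> (m + 1) * (nodes (s 0) + 1) ^ k)"
proof -
  obtain c1 k1 where c1: "\<And>s. \<exists>t s'. exec c1 s t s' \<and> s' 0 = init (s 0) \<and> t \<le> (nodes (s 0) + 1) ^ k1"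
    using ptime_exec[OF init] by blast
  obtain c2 k2 where c2: "\<And>s. \<exists>t s'. exec c2 s t s' \<and> s' 0 = step (s 0) \<and> t \<le> (nodes (s 0) + 1) ^ k2"
    using ptime_exec[OF step] by blast
  obtain c3 k3 where c3: "\<And>s. \<exists>t s'. exec c3 s t s' \<and> s' 0 = final (s 0) \<and> t \<le> (nodes (s 0) + 1) ^ k3"
    using ptime_exec[OF final] by blast
  obtain l where l: "nodes (step y) \<le> (nodes y + 1) ^ l" for y
    using poly_bounded_ptime[OF step] unfolding poly_bounded_def by blast
  \<comment> \<open>Bounds every state: the initial one, which is also the last if
    \<open>m = 0\<close>, those covered by \<open>B\<close>, and the result of one further
    step.\<close>
  define M where "M x = nodes (init x) + B x + (B x + 1) ^ l" for x
  define D where "D x = 2 + M x + (M x + 1) ^ k2" for x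
  have M: "poly_bounded M"
    unfolding M_def by (intro poly_bounded_intros poly_bounded_ptime init B)
  then have "poly_bounded (\<lambda>x. (nodes x + 1) ^ k1 + D x + (M x + 1) ^ k3)"
    unfolding D_def by (intro poly_bounded_intros)
  then obtain k where k: "(nodes x + 1) ^ k1 + D x + (M x + 1) ^ k3 \<le> (nodes x + 1) ^ k" for x
    unfolding poly_bounded_def by blast
  let ?c = "Seq c1 (Seq (While (HeadE (Var 0)) c2) c3)"
  have "\<exists>t s'. exec ?c s t s' \<and> s' 0 = final ((step ^^ m) (init (s 0))) \<and>
      t \<le> (m + 1) * (nodes (s 0) + 1) ^ k"
    if run: "\<And>i. i < m \<Longrightarrow> head ((step ^^ i) (init (s 0))) \<noteq> Leaf"
        "\<And>i. i < m \<Longrightarrow> nodes ((step ^^ i) (init (s 0))) \<le> B (s 0)"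
      and stop: "head ((step ^^ m) (init (s 0))) = Leaf"
    for s m
  proof -
    let ?x = "s 0"
    have size: "nodes ((step ^^ i) (init ?x)) \<le> M ?x" if "i \<le> m" for i
    proof (cases i)
      case (Suc j)
      then have "j < m"
        using that by simp
      have "nodes ((step ^^ i) (init ?x)) \<le> (nodes ((step ^^ j) (init ?x)) + 1) ^ l"
        using l by (simp add: Suc)
      also have "\<dots> \<le> (B ?x + 1) ^ l"
        using run(2)[OF \<open>j < m\<close>] by (intro power_mono) auto
      finally show ?thesis
        by (simp add: M_def)
    qed (simp add: M_def)
    obtain t1 s1 where 1: "exec c1 s t1 s1" "s1 0 = init ?x" "t1 \<le> (nodes ?x + 1) ^ k1"
      using c1 by blast
    have "\<exists>t s'. exec (While (HeadE (Var 0)) c2) s1 t s' \<and> s' 0 = (step ^^ m) (s1 0) \<and>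
        t \<le> (m + 1) * D ?x"
    proof (rule exec_While_funpow[OF c2])
      fix i assume i: "i \<le> m"
      have "(nodes ((step ^^ i) (s1 0)) + 1) ^ k2 \<le> (M ?x + 1) ^ k2"
        using size[OF i] by (intro power_mono) (auto simp: 1)
      then show "2 + nodes ((step ^^ i) (s1 0)) + (nodes ((step ^^ i) (s1 0)) + 1) ^ k2 \<le> D ?x"
        using size[OF i] by (simp add: D_def 1)
    qed (use run stop 1(2) in auto)
    then obtain t2 s2 where 2: "exec (While (HeadE (Var 0)) c2) s1 t2 s2"
        "s2 0 = (step ^^ m) (init ?x)" "t2 \<le> (m + 1) * D ?x"
      unfolding 1(2) by blast
    obtain t3 s3 where 3: "exec c3 s2 t3 s3" "s3 0 = final (s2 0)" "t3 \<le> (nodes (s2 0) + 1) ^ k3"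
      using c3 by blast
    have "t3 \<le> (M ?x + 1) ^ k3"
      using 3(3) size[of m] power_mono[of "nodes (s2 0) + 1" "M ?x + 1" k3] by (simp add: 2(2))
    then have "t1 + (t2 + t3) \<le> (m + 1) * ((nodes ?x + 1) ^ k1 + D ?x + (M ?x + 1) ^ k3)"
      using 1(3) 2(3) by (simp add: algebra_simps)
    also have "\<dots> \<le> (m + 1) * (nodes ?x + 1) ^ k"
      by (intro mult_le_mono2 k)
    finally show ?thesis
      using exec.Seq[OF 1(1) exec.Seq[OF 2(1) 3(1)]] 2(2) 3(2) by auto
  qed
  then show ?thesis
    by (intro exI[of _ ?c] exI[of _ k]) blast
qed

section \<open>The countdown over all orders\<close>

lemma prod_list_Suc_rev_upt: "prod_list (map Suc (rev [0..<m])) = fact m"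
  by (induction m) (simp_all add: algebra_simps)

lemma nodes_encode_digits:
  assumes "set Ls \<subseteq> {..<m}"
  shows "nodes (encode_digits (digits i Ls)) \<le> 1 + length Ls * (4 * m + 3)"
  using assms
proof (induction Ls arbitrary: i)
  case (Cons L Ls)
  have "i mod Suc L \<le> L"
    by (meson less_Suc_eq_le mod_less_divisor zero_less_Suc)
  then have "nodes (encode_digit (i mod Suc L, L)) \<le> 4 * L + 3"
    unfolding encode_digit_def nodes.simps nodes_encode_nat fst_conv snd_conv by linarith
  moreover have "nodes (encode_digits (digits (i div Suc L) Ls)) \<le> 1 + length Ls * (4 * m + 3)"
    using Cons by simp
  ultimately show ?case
    using Cons.prems by simp
qed simp

definition search_state :: "goa \<Rightarrow> nat \<Rightarrow> tree \<Rightarrow> tree" where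
  "search_state x i acc = Node True_tree
     (Node (encode_digits (digits i (rev [0..<num_agents x]))) (Node acc (encode x)))"

text \<open>The reversal is inherited from \<open>pick_tree\<close>; it only permutes the numbering
  of the orders.\<close>

definition test_at :: "goa \<Rightarrow> nat \<Rightarrow> bool" where
  "test_at x i = order_test x (rev (pick [0..<num_agents x] (digits i (rev [0..<num_agents x]))))"

lemma head_encode [simp]:
  "head (encode x) = encode_nat (num_agents x)"
  "head (tail (tail (encode x))) = encode_list encode_layer (profiles x)"
  "tail (tail (tail (encode x))) = encode_nat (alpha x)"
  by (simp_all add: encode_def)

lemma init_tree_encode: "init_tree (encode x) = search_state x (fact (num_agents x) - 1) Leaf"
  by (simp add: init_tree_def search_state_def full_digits_tree_encode)

text \<open>After \<open>i = 0\<close> the counter wraps around and the state is no longer a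
  \<open>search_state\<close>, so for this case only the two flags are described.\<close>

lemma step_tree_search_state:
  fixes acc :: tree
  assumes x: "goa_instance x" and i: "i < fact (num_agents x)"
  defines "acc' \<equiv> if test_at x i then True_tree else acc"
  shows "0 < i \<Longrightarrow> step_tree (search_state x i acc) = search_state x (i - 1) acc'"
    and "i = 0 \<Longrightarrow> head (step_tree (search_state x i acc)) = Leaf"
    and "head (tail (tail (step_tree (search_state x i acc)))) = acc'"
proof -
  let ?ds = "digits i (rev [0..<num_agents x])"
  let ?\<pi> = "rev (pick [0..<num_agents x] ?ds)"
  have "set ?\<pi> \<subseteq> {..<num_agents x}"
    using pick_permutation[of "[0..<num_agents x]" ?ds] by auto
  from order_test_tree_eq_Leaf[OF x this]
  have "order_test_tree (encode_list encode_layer (profiles x)) (encode_nat (alpha x))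
      (pick_tree (encode_list encode_nat [0..<num_agents x]) (encode_digits ?ds)) = Leaf \<longleftrightarrow> \<not> test_at x i"
    by (simp add: pick_tree_encode test_at_def)
  then have eq: "step_tree (search_state x i acc) =
      Node (not_tree (head (decrement_tree (encode_digits ?ds))))
        (Node (rev_tree (tail (decrement_tree (encode_digits ?ds)))) (Node acc' (encode x)))"
    by (simp add: step_tree_def search_state_def acc'_def)
  note decr = decrement_tree_encode[of i "rev [0..<num_agents x]", unfolded prod_list_Suc_rev_upt, OF i]
  show "0 < i \<Longrightarrow> step_tree (search_state x i acc) = search_state x (i - 1) acc'"
    using decr(2) unfolding eq by (simp add: search_state_def not_tree_def)
  show "i = 0 \<Longrightarrow> head (step_tree (search_state x i acc)) = Leaf"
    using decr(1) unfolding eq by simp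
  show "head (tail (tail (step_tree (search_state x i acc)))) = acc'"
    unfolding eq by simp
qed

lemma funpow_step_tree:
  assumes x: "goa_instance x" and m: "m < fact (num_agents x)"
  shows "\<exists>acc. (step_tree ^^ m) (init_tree (encode x)) = search_state x (fact (num_agents x) - 1 - m) acc \<and>
    acc = (if \<exists>i < fact (num_agents x). fact (num_agents x) - 1 - m < i \<and> test_at x i
      then True_tree else Leaf)"
  using m
proof (induction m)
  case 0
  show ?case
    by (auto simp: init_tree_encode)
next
  case (Suc m)
  let ?N = "fact (num_agents x) :: nat"
  let ?i = "?N - 1 - m"
  obtain acc where acc: "(step_tree ^^ m) (init_tree (encode x)) = search_state x ?i acc"
      "acc = (if \<exists>i < ?N. ?i < i \<and> test_at x i then True_tree else Leaf)"
    using Suc by auto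
  have i: "?i < ?N" "0 < ?i" "?i - 1 = ?N - 1 - Suc m"
    using Suc.prems by auto
  have "(\<exists>i < ?N. ?i - 1 < i \<and> test_at x i) \<longleftrightarrow> test_at x ?i \<or> (\<exists>i < ?N. ?i < i \<and> test_at x i)"
  proof -
    have "?i - 1 < i \<longleftrightarrow> i = ?i \<or> ?i < i" for i
      using i(2) by linarith
    then have "(\<exists>i < ?N. ?i - 1 < i \<and> test_at x i) \<longleftrightarrow>
        (\<exists>i < ?N. (i = ?i \<or> ?i < i) \<and> test_at x i)"
      by simp
    then show ?thesis
      using i(1) by blast
  qed
  then have "(if test_at x ?i then True_tree else acc) =
      (if \<exists>i < ?N. ?i - 1 < i \<and> test_at x i then True_tree else Leaf)"
    unfolding acc(2) by auto
  moreover have "(step_tree ^^ Suc m) (init_tree (encode x)) =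
      search_state x (?i - 1) (if test_at x ?i then True_tree else acc)"
    using step_tree_search_state(1)[OF x i(1,2), of acc] acc(1) by simp
  ultimately show ?case
    unfolding i(3) by blast
qed

lemma ex_test_at_iff:
  assumes x: "goa_instance x"
  shows "(\<exists>i < fact (num_agents x). test_at x i) \<longleftrightarrow> (\<exists>p. globally_optimal x p)"
proof -
  let ?R = "[0..<num_agents x]"
  have "(\<exists>i < fact (num_agents x). test_at x i) \<longleftrightarrow>
      (\<exists>\<pi>. distinct \<pi> \<and> set \<pi> = {..<num_agents x} \<and> order_test x \<pi>)"
  proof
    assume "\<exists>i < fact (num_agents x). test_at x i"
    then obtain i where "test_at x i"
      by blast
    then have "order_test x (rev (pick ?R (digits i (rev ?R))))"
      unfolding test_at_def .
    moreover have "distinct (pick ?R (digits i (rev ?R))) \<and> set (pick ?R (digits i (rev ?R))) = set ?R"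
      by (rule pick_permutation) simp_all
    ultimately show "\<exists>\<pi>. distinct \<pi> \<and> set \<pi> = {..<num_agents x} \<and> order_test x \<pi>"
      by (intro exI[of _ "rev (pick ?R (digits i (rev ?R)))"]) (simp add: atLeast0LessThan)
  next
    assume "\<exists>\<pi>. distinct \<pi> \<and> set \<pi> = {..<num_agents x} \<and> order_test x \<pi>"
    then obtain \<pi> where \<pi>: "distinct \<pi>" "set \<pi> = {..<num_agents x}" "order_test x \<pi>"
      by blast
    \<comment> \<open>The number sought is that of \<open>rev \<pi>\<close>, because
      \<open>test_at\<close> reverses the picked list.\<close>
    have "\<exists>i < fact (num_agents x). pick ?R (digits i (rev ?R)) = rev \<pi>"
      by (rule pick_surj) (simp_all add: \<pi> atLeast0LessThan)
    then obtain i where "i < fact (num_agents x)" "pick ?R (digits i (rev ?R)) = rev \<pi>"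
      by blast
    then show "\<exists>i < fact (num_agents x). test_at x i"
      using \<pi>(3) unfolding test_at_def by auto
  qed
  then show ?thesis
    using globally_optimal_iff_order_test[OF x] by simp
qed

theorem theorem1:
  shows "\<exists>(c :: com) (k :: nat). \<forall>x. goa_instance x \<longrightarrow>
    (\<exists>t s. exec c (input_state (encode x)) t s \<and>
           (accepting s \<longleftrightarrow> (\<exists>p. globally_optimal x p)) \<and>
           t \<le> fact (num_agents x) * input_length x ^ k)"
proof -
  \<comment> \<open>The digits occupy at most \<open>1 + n * (4 * n + 3)\<close> nodes and
    \<open>n\<close> is at most the input size; the input itself and a few flag nodes are added. The
    factor 100 is generous.\<close>
  let ?B = "\<lambda>y. 100 * (nodes y + 1) ^ 2"
  have "ptime (\<lambda>y. head (tail (tail y)))"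
    by (intro ptime_intros)
  moreover have "poly_bounded ?B"
    by (intro poly_bounded_intros)
  ultimately obtain c k where c: "\<And>s m.
      (\<forall>i < m. head ((step_tree ^^ i) (init_tree (s 0))) \<noteq> Leaf \<and>
        nodes ((step_tree ^^ i) (init_tree (s 0))) \<le> ?B (s 0)) \<Longrightarrow>
      head ((step_tree ^^ m) (init_tree (s 0))) = Leaf \<Longrightarrow>
      (\<exists>t s'. exec c s t s' \<and> s' 0 = head (tail (tail ((step_tree ^^ m) (init_tree (s 0))))) \<and>
        t \<le> (m + 1) * (nodes (s 0) + 1) ^ k)"
    using ptime_loop[OF ptime_init_tree ptime_step_tree] by blast
  \<comment> \<open>With input length \<open>l \<ge> 2\<close>, \<open>l + 1 \<le> l ^ 2\<close>
    doubles the exponent \<open>k\<close>, and one further factor \<open>l\<close> absorbs the extra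
    1 in \<open>(n! + 1)\<close>, the number of loop tests.\<close>
  have "\<exists>t s. exec c (input_state (encode x)) t s \<and>
      (accepting s \<longleftrightarrow> (\<exists>p. globally_optimal x p)) \<and>
      t \<le> fact (num_agents x) * input_length x ^ (2 * k + 1)"
    if x: "goa_instance x" for x
  proof -
    let ?N = "fact (num_agents x) :: nat"
    let ?y = "\<lambda>m. (step_tree ^^ m) (init_tree (encode x))"
    have N: "?N \<ge> 1"
      by (rule fact_ge_1)
    have "head (?y m) \<noteq> Leaf \<and> nodes (?y m) \<le> ?B (encode x)" if m: "m < ?N" for m
    proof -
      let ?n = "num_agents x"
      obtain acc where acc: "?y m = search_state x (?N - 1 - m) acc" "nodes acc \<le> 3"
        using funpow_step_tree[OF x m] by fastforce
      have "nodes (encode_digits (digits (?N - 1 - m) (rev [0..<?n]))) \<le> 1 + ?n * (4 * ?n + 3)"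
        using nodes_encode_digits[of "rev [0..<?n]" ?n "?N - 1 - m"]
        by (simp add: atLeast0LessThan)
      moreover have n: "?n \<le> nodes (encode x)"
        by (simp add: encode_def nodes_encode_nat)
      then have "?n * (4 * ?n + 3) \<le> nodes (encode x) * (4 * nodes (encode x) + 3)"
        by (intro mult_le_mono) auto
      ultimately have "nodes (?y m) \<le> ?B (encode x)"
        using acc unfolding acc(1) search_state_def
        by (simp add: power2_eq_square algebra_simps)
      then show ?thesis
        by (simp add: acc search_state_def)
    qed
    moreover obtain acc where acc: "?y (?N - 1) = search_state x 0 acc"
        "acc = (if \<exists>i < ?N. 0 < i \<and> test_at x i then True_tree else Leaf)"
      using funpow_step_tree[OF x, of "?N - 1"] N by auto
    \<comment> \<open>After \<open>?N - 1\<close> rounds the counter is 0; round \<open>?N\<close>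
      tests that last order and ends the loop.\<close>
    have last: "?y ?N = step_tree (search_state x 0 acc)"
      using N acc(1) by (cases ?N) auto
    moreover have "head (?y ?N) = Leaf"
      unfolding last using step_tree_search_state(2)[OF x, of 0] N by simp
    ultimately obtain t s where s: "exec c (input_state (encode x)) t s" "s 0 = head (tail (tail (?y ?N)))"
        "t \<le> (?N + 1) * (input_length x + 1) ^ k"
      using c[of ?N "input_state (encode x)"] by (auto simp: input_state_def input_length_def)
    have "s 0 = (if test_at x 0 then True_tree else acc)"
      unfolding s(2) last using step_tree_search_state(3)[OF x, of 0 acc] N by simp
    moreover have "(\<exists>i < ?N. test_at x i) \<longleftrightarrow> test_at x 0 \<or> (\<exists>i < ?N. 0 < i \<and> test_at x i)"
    proof -
      have "i = 0 \<or> 0 < i" for i :: nat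
        by auto
      moreover have "0 < ?N"
        by simp
      ultimately show ?thesis
        by metis
    qed
    ultimately have "s 0 \<noteq> Leaf \<longleftrightarrow> (\<exists>i < ?N. test_at x i)"
      using acc(2) by simp
    then have accepting: "accepting s \<longleftrightarrow> (\<exists>p. globally_optimal x p)"
      unfolding accepting_def ex_test_at_iff[OF x] .
    let ?l = "input_length x"
    have l: "2 \<le> ?l"
      by (simp add: input_length_def encode_def)
    then have "?l + 1 \<le> ?l ^ 2"
      using mult_le_mono1[OF l, of ?l] unfolding power2_eq_square by linarith
    then have "(?l + 1) ^ k \<le> (?l ^ 2) ^ k"
      by (intro power_mono) auto
    moreover have "?N + 1 \<le> ?N * ?l"
      using mult_le_mono2[OF l, of ?N] N by linarith
    ultimately have "(?N + 1) * (?l + 1) ^ k \<le> (?N * ?l) * (?l ^ 2) ^ k"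
      by (intro mult_le_mono)
    moreover have "?N * ?l * (?l ^ 2) ^ k = ?N * ?l ^ (2 * k + 1)"
      by (simp flip: power_mult)
    ultimately have "t \<le> ?N * ?l ^ (2 * k + 1)"
      using s(3) by linarith
    then show ?thesis
      using s(1) accepting by blast
  qed
  then show ?thesis
    by blast
qed

end
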